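(* Let $G$ be a cyclic group of order $pq$, where $p,q$ are primes with $p + \lfloor 2\sqrt{p-2} \rfloor + 1 < q < 2p$. Then $\mathsf{cr}(G) = p+q-2$.
   Context: For a finite abelian group $G$ (written additively) and a finite subset $A \subset G$, $\Sigma(A)$ denotes the set of all sums $\sum_{a \in I} a$ over nonempty subsets $I \subset A$. The critical number $\mathsf{cr}(G)$ is the smallest positive integer $\ell$ such that every subset $S \subset G \setminus \{0\}$ with $|S| \ge \ell$ satisfies $\Sigma(S) = G$. *)

theory Defs
  imports Complex_Main "HOL-Algebra.Elementary_Groups" "HOL-Algebra.FiniteProduct" "HOL-Computational_Algebra.Primes"
begin

text \<open>
  Abelian groups are those of HOL-Algebra, hence written multiplicatively: the sum of the
  elements of \<open>I\<close> is \<open>finprod G (\<lambda>a. a) I\<close>, and \<open>0\<close> is \<open>\<one>\<^bsub>G\<^esub>\<close>.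
  Both definitions are meant for a finite abelian group \<open>G\<close>.
\<close>

definition subset_sums :: "('a, 'b) monoid_scheme \<Rightarrow> 'a set \<Rightarrow> 'a set" where
  "subset_sums G A = {finprod G (\<lambda>a. a) I | I. I \<subseteq> A \<and> I \<noteq> {}}"

text \<open>
  The \<open>LEAST\<close> is well defined: for \<open>l > order G\<close> the condition on \<open>l\<close> is vacuous.
\<close>

definition critical_number :: "('a, 'b) monoid_scheme \<Rightarrow> nat" where
  "critical_number G = (LEAST l. 0 < l \<and>
     (\<forall>S. S \<subseteq> carrier G - {\<one>\<^bsub>G\<^esub>} \<and> card S \<ge> l \<longrightarrow> subset_sums G S = carrier G))"

end

theory Submission
  imports Defs "Jordan_Normal_Form.Determinant" "HOL-Computational_Algebra.Formal_Power_Series"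
    "HOL-Algebra.Multiplicative_Group"
begin

hide_const (open) Polynomial.order up_ring.coeff up_ring.monom

text \<open>
  For the upper bound, identify the group with the integers modulo \<open>p * q\<close>, adjoin \<open>0\<close> to a set
  of \<open>p + q - 2\<close> nonzero elements and sort the result by residues \<open>f\<close> modulo \<open>p\<close> into classes of
  sizes \<open>n f\<close>.  Taking sums of \<open>t f\<close> elements of each class fixes the sum modulo \<open>p\<close>, and by the
  theorems of Dias da Silva--Hamidoune and Cauchy--Davenport it reaches all residues modulo \<open>q\<close>
  once \<open>\<Sum>f. t f * (n f - t f) \<ge> q - 1\<close>.  The balanced choice \<open>t f = n f div 2\<close> always satisfies
  this, because its terms are at least \<open>n f - 1\<close>, which add up to \<open>q - 1\<close>.  To reach a prescribed residue modulo \<open>p\<close>, a few of the \<open>t f\<close>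
  are increased by one: this is free when \<open>n f\<close> is odd and costs one when \<open>n f\<close> is even.  Either
  there are so many odd classes that the subset sums of their residues cover everything modulo \<open>p\<close>,
  or the hypothesis on \<open>q\<close> forces some class to have at least four elements, which pays for
  the increments.  If few residues occur or the class of \<open>0\<close> is large, there is enough slack to
  let the \<open>t f\<close> run over intervals instead.

  For the lower bound, take all nonzero multiples of \<open>p\<close> and \<open>p - 2\<close> elements congruent to \<open>1\<close>
  modulo \<open>p\<close>: no subset sum is congruent to \<open>p - 1\<close> modulo \<open>p\<close>.
\<close>

section \<open>Coefficients of products of power sums\<close>

no_notation vec_index (infixl "$" 100)
unbundle fps_syntax

text \<open>Derivative at \<open>a\<close> of the monic polynomial with simple roots
  \<open>A\<close>; its inverse is the barycentric weight of Lagrange interpolation.\<close>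

definition nodal_weight :: "'a::field set \<Rightarrow> 'a \<Rightarrow> 'a" where
  "nodal_weight A a = (\<Prod>b\<in>A - {a}. a - b)"

lemma nodal_weight_nonzero: "finite A \<Longrightarrow> nodal_weight A a \<noteq> 0"
  by (auto simp: nodal_weight_def)

text \<open>Lagrange interpolation at the nodes \<open>A\<close> reproduces the monomial of exponent
  \<open>e\<close>; comparing coefficients of degree \<open>card A - 1\<close> gives the
  formula.\<close>

lemma sum_power_over_nodal_weight:
  fixes A :: "'a::field set"
  assumes A: "finite A" and e: "e < card A"
  shows "(\<Sum>a\<in>A. a ^ e / nodal_weight A a) = (if Suc e = card A then 1 else 0)"
proof -
  define L where "L a = (\<Prod>b\<in>A - {a}. [:- b, 1:])" for a
  define p where "p = (\<Sum>a\<in>A. smult (a ^ e / nodal_weight A a) (L a))"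
  have deg_L: "degree (L a) = card A - 1" if "a \<in> A" for a
    unfolding L_def using A that by (subst degree_prod_sum_eq) auto
  have "lead_coeff (L a) = 1" for a
    unfolding L_def by (simp add: lead_coeff_prod)
  then have coeff_L: "coeff (L a) (card A - 1) = 1" if "a \<in> A" for a
    using deg_L[OF that] by metis
  have poly_L: "poly (L a) x = (if x = a then nodal_weight A a else 0)" if "a \<in> A" "x \<in> A" for a x
    using that A by (auto simp: L_def nodal_weight_def poly_prod)
  have "p = monom 1 e"
  proof (rule poly_eqI_degree[of A])
    fix x assume x: "x \<in> A"
    have "poly p x = (\<Sum>a\<in>A. if x = a then x ^ e else 0)"
      unfolding p_def poly_sum using x A nodal_weight_nonzero[OF A]
      by (intro sum.cong) (auto simp: poly_L)
    then show "poly p x = poly (monom 1 e) x"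
      using x A by (simp add: poly_monom)
  next
    have "degree p \<le> card A - 1"
      unfolding p_def by (rule degree_sum_le) (use A deg_L in \<open>auto intro: order_trans[OF degree_smult_le]\<close>)
    then show "degree p < card A" using e by linarith
    show "degree (monom 1 e :: 'a poly) < card A"
      using e by (simp add: degree_monom_eq)
  qed
  then have "coeff p (card A - 1) = (if e = card A - 1 then 1 else 0)"
    by simp
  moreover have "coeff p (card A - 1) = (\<Sum>a\<in>A. a ^ e / nodal_weight A a)"
    unfolding p_def coeff_sum by (intro sum.cong) (simp_all add: coeff_L del: One_nat_def)
  moreover have "e = card A - 1 \<longleftrightarrow> Suc e = card A" using e by linarith
  ultimately show ?thesis by simp
qed

text \<open>As \<open>f j\<close> starts at index \<open>d j\<close>, a coefficient of the product
  at index at most \<open>sum d J\<close> sees only the product of the lowest terms.\<close>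

lemma fps_prod_nth_lowest:
  fixes f :: "'i \<Rightarrow> 'a::comm_ring_1 fps"
  assumes "finite J" and "\<And>j k. j \<in> J \<Longrightarrow> k < d j \<Longrightarrow> f j $ k = 0" and "m \<le> sum d J"
  shows "(\<Prod>j\<in>J. f j) $ m = (if m = sum d J then \<Prod>j\<in>J. f j $ d j else 0)"
  using assms
proof (induction J arbitrary: m rule: finite_induct)
  case empty
  then show ?case by simp
next
  case (insert x J)
  have low: "(\<Prod>j\<in>J. f j) $ k = (if k = sum d J then \<Prod>j\<in>J. f j $ d j else 0)" if "k \<le> sum d J" for k
    using insert.IH[of k] insert.prems that by auto
  have m: "m \<le> d x + sum d J" using insert by simp
  have "(\<Prod>j\<in>insert x J. f j) $ m = (\<Sum>i=0..m. f x $ i * (\<Prod>j\<in>J. f j) $ (m - i))"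
    using insert.hyps by (simp add: fps_mult_nth)
  also have "\<dots> = (\<Sum>i=0..m. if i = d x \<and> m = d x + sum d J then f x $ d x * (\<Prod>j\<in>J. f j $ d j) else 0)"
  proof (rule sum.cong[OF refl])
    fix i assume i: "i \<in> {0..m}"
    consider "i < d x" | "i \<ge> d x" by linarith
    then show "f x $ i * (\<Prod>j\<in>J. f j) $ (m - i) =
      (if i = d x \<and> m = d x + sum d J then f x $ d x * (\<Prod>j\<in>J. f j $ d j) else 0)"
    proof cases
      case 1
      then show ?thesis using insert.prems(1)[of x i] by auto
    next
      case 2
      then have le: "m - i \<le> sum d J" using m by linarith
      show ?thesis
      proof (cases "m - i = sum d J")
        case True
        show ?thesis
        proof (cases "i = d x")
          case True
          then show ?thesis using low[OF le] i \<open>m - i = sum d J\<close> by auto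
        next
          case False
          then have "i = m \<and> sum d J = 0" using True 2 m i by auto
          then have False using False 2 m by auto
          then show ?thesis ..
        qed
      next
        case False
        then show ?thesis using low[OF le] by auto
      qed
    qed
  qed
  also have "\<dots> = (if m = d x + sum d J then f x $ d x * (\<Prod>j\<in>J. f j $ d j) else 0)"
    by (cases "m = d x + sum d J") (auto simp: sum.delta)
  finally show ?case using insert.hyps by simp
qed

lemma fps_exp_sum:
  fixes a :: "'i \<Rightarrow> 'a::field_char_0"
  assumes "finite J"
  shows "(\<Prod>j\<in>J. fps_exp (a j)) = fps_exp (\<Sum>j\<in>J. a j)"
  using assms by (induction J rule: finite_induct) (simp_all add: fps_exp_add_mult)

text \<open>
  The left-hand side is \<open>m!\<close> times the coefficient of \<open>X^m\<close> in the product over \<open>j\<close> of the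
  exponential generating functions of \<open>k \<mapsto> \<Sum>a\<in>A j. a ^ (e j + k) / nodal_weight (A j) a\<close>.
\<close>

lemma sum_PiE_power_over_nodal_weight:
  fixes A :: "'i \<Rightarrow> 'a::field_char_0 set"
  assumes J: "finite J" and A: "\<And>j. j \<in> J \<Longrightarrow> finite (A j)" "\<And>j. j \<in> J \<Longrightarrow> A j \<noteq> {}"
    and m: "m + (\<Sum>j\<in>J. e j) \<le> (\<Sum>j\<in>J. card (A j) - 1)"
  shows "(\<Sum>a\<in>PiE J A. (\<Sum>j\<in>J. a j) ^ m * (\<Prod>j\<in>J. a j ^ e j / nodal_weight (A j) (a j))) =
    (if m + (\<Sum>j\<in>J. e j) = (\<Sum>j\<in>J. card (A j) - 1)
     then fact m * (\<Prod>j\<in>J. if e j < card (A j) then 1 / fact (card (A j) - 1 - e j) else 0) else 0)"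
    (is "?L = ?R")
proof -
  define F where "F j = (\<Sum>a\<in>A j. fps_const (a ^ e j / nodal_weight (A j) a) * fps_exp a)" for j
  \<comment> \<open>Lowest index of \<open>F j\<close> when \<open>e j < card (A j)\<close>;
    otherwise truncated subtraction makes it \<open>0\<close>.\<close>
  define d where "d j = card (A j) - 1 - e j" for j
  have F_nth: "F j $ k = (\<Sum>a\<in>A j. a ^ (e j + k) / nodal_weight (A j) a) / fact k" for j k
    by (simp add: F_def fps_sum_nth sum_divide_distrib power_add)
  have card_pos: "card (A j) > 0" if "j \<in> J" for j
    using A that by (simp add: card_gt_0_iff)
  have F_low: "F j $ k = 0" if "j \<in> J" "k < d j" for j k
    using that sum_power_over_nodal_weight[OF A(1), of j "e j + k"]
    by (auto simp: F_nth d_def)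
  have F_d: "F j $ d j = 1 / fact (d j)" if "j \<in> J" "e j < card (A j)" for j
    using that sum_power_over_nodal_weight[OF A(1), of j "e j + d j"]
    by (auto simp: F_nth d_def)
  have "(\<Prod>j\<in>J. F j) = (\<Sum>a\<in>PiE J A. \<Prod>j\<in>J. fps_const (a j ^ e j / nodal_weight (A j) (a j)) * fps_exp (a j))"
    unfolding F_def by (rule prod_sum_PiE) (use J A in auto)
  also have "\<dots> = (\<Sum>a\<in>PiE J A. fps_const (\<Prod>j\<in>J. a j ^ e j / nodal_weight (A j) (a j)) * fps_exp (\<Sum>j\<in>J. a j))"
  proof (rule sum.cong[OF refl])
    fix a
    have "(\<Prod>j\<in>J. fps_const (c j)) = fps_const (\<Prod>j\<in>J. c j)" for c :: "'i \<Rightarrow> 'a"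
      using J by (induction J rule: finite_induct) (simp_all flip: fps_const_mult)
    then show "(\<Prod>j\<in>J. fps_const (a j ^ e j / nodal_weight (A j) (a j)) * fps_exp (a j)) =
      fps_const (\<Prod>j\<in>J. a j ^ e j / nodal_weight (A j) (a j)) * fps_exp (\<Sum>j\<in>J. a j)"
      using fps_exp_sum[OF J, of a] by (simp add: prod.distrib)
  qed
  finally have "(\<Prod>j\<in>J. F j) $ m = ?L / fact m"
    by (simp add: fps_sum_nth sum_divide_distrib mult.commute)
  then have L: "?L = fact m * (\<Prod>j\<in>J. F j) $ m" by simp
  have m_le: "m + (\<Sum>j\<in>J. e j) \<le> (\<Sum>j\<in>J. d j + e j)"
    using m by (rule order_trans) (auto intro!: sum_mono simp: d_def)
  then have le: "m \<le> sum d J" by (simp add: sum.distrib)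
  show ?thesis
  proof (cases "\<forall>j\<in>J. e j < card (A j)")
    case True
    then have "(\<Sum>j\<in>J. d j + e j) = (\<Sum>j\<in>J. card (A j) - 1)"
      by (intro sum.cong) (auto simp: d_def)
    then have eq: "m = sum d J \<longleftrightarrow> m + (\<Sum>j\<in>J. e j) = (\<Sum>j\<in>J. card (A j) - 1)"
      by (auto simp: sum.distrib)
    have "(\<Prod>j\<in>J. F j) $ m = (if m = sum d J then \<Prod>j\<in>J. F j $ d j else 0)"
      by (rule fps_prod_nth_lowest[OF J F_low le])
    moreover have "(\<Prod>j\<in>J. F j $ d j) = (\<Prod>j\<in>J. if e j < card (A j) then 1 / fact (card (A j) - 1 - e j) else 0)"
      using True F_d by (intro prod.cong) (auto simp: d_def)
    ultimately show ?thesis using L eq by simp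
  next
    case False
    then obtain i where i: "i \<in> J" "\<not> e i < card (A i)" by blast
    \<comment> \<open>At \<open>i\<close> the truncation makes \<open>d i + e i\<close> exceed
      \<open>card (A i) - 1\<close>, so \<open>m\<close> lies strictly below the first possible
      index and the coefficient vanishes.\<close>
    have "(\<Sum>j\<in>J. card (A j) - 1) < (\<Sum>j\<in>J. d j + e j)"
    proof (rule sum_strict_mono_ex1[OF J])
      show "\<exists>j\<in>J. card (A j) - 1 < d j + e j"
        using i card_pos[of i] by (intro bexI[of _ i]) auto
    qed (auto simp: d_def)
    then have "m < sum d J" using m by (simp add: sum.distrib)
    then have "(\<Prod>j\<in>J. F j) $ m = 0"
      using fps_prod_nth_lowest[OF J F_low le] by simp
    moreover have "(\<Prod>j\<in>J. if e j < card (A j) then 1 / fact (card (A j) - 1 - e j) else (0::'a)) = 0"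
      using i J by (intro prod_zero) auto
    ultimately show ?thesis using L by simp
  qed
qed

text \<open>Powers of the sum below \<open>degree g\<close> contribute nothing, so a monic
  \<open>g\<close> acts like its leading monomial. This leaves the roots of \<open>g\<close> free to
  choose.\<close>

lemma sum_PiE_poly_over_nodal_weight:
  fixes A :: "'i \<Rightarrow> 'a::field_char_0 set"
  assumes J: "finite J" and A: "\<And>j. j \<in> J \<Longrightarrow> finite (A j)" "\<And>j. j \<in> J \<Longrightarrow> A j \<noteq> {}"
    and g: "lead_coeff g = 1" "degree g + (\<Sum>j\<in>J. e j) = (\<Sum>j\<in>J. card (A j) - 1)"
  shows "(\<Sum>a\<in>PiE J A. poly g (\<Sum>j\<in>J. a j) * (\<Prod>j\<in>J. a j ^ e j / nodal_weight (A j) (a j))) =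
    fact (degree g) * (\<Prod>j\<in>J. if e j < card (A j) then 1 / fact (card (A j) - 1 - e j) else 0)"
    (is "?L = ?R")
proof -
  have "?L = (\<Sum>a\<in>PiE J A. \<Sum>m\<le>degree g. coeff g m * ((\<Sum>j\<in>J. a j) ^ m * (\<Prod>j\<in>J. a j ^ e j / nodal_weight (A j) (a j))))"
    by (simp add: poly_altdef sum_distrib_right mult.assoc)
  also have "\<dots> = (\<Sum>m\<le>degree g. coeff g m * (\<Sum>a\<in>PiE J A. (\<Sum>j\<in>J. a j) ^ m * (\<Prod>j\<in>J. a j ^ e j / nodal_weight (A j) (a j))))"
    by (subst sum.swap) (simp add: sum_distrib_left)
  also have "\<dots> = (\<Sum>m\<le>degree g. if m = degree g then ?R else 0)"
  proof (rule sum.cong[OF refl])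
    fix m assume "m \<in> {..degree g}"
    then have "m + (\<Sum>j\<in>J. e j) \<le> (\<Sum>j\<in>J. card (A j) - 1)" using g(2) by auto
    note eq = sum_PiE_power_over_nodal_weight[OF J A this]
    show "coeff g m * (\<Sum>a\<in>PiE J A. (\<Sum>j\<in>J. a j) ^ m * (\<Prod>j\<in>J. a j ^ e j / nodal_weight (A j) (a j))) =
      (if m = degree g then ?R else 0)"
    proof (cases "m = degree g")
      case True
      show ?thesis using eq g(2) unfolding True g(1) by simp
    next
      case False
      then show ?thesis using eq g(2) by simp
    qed
  qed
  finally show ?thesis by simp
qed

text \<open>Vandermonde argument: with the last point as a variable, the determinant is a polynomial
  that vanishes at the other points and has the smaller determinant as its leading
  coefficient.\<close>

lemma det_monic_polys:
  fixes P :: "nat \<Rightarrow> 'a::idom poly" and b :: "nat \<Rightarrow> 'a"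
  assumes "\<And>j. degree (P j) = j" "\<And>j. lead_coeff (P j) = 1" and "inj_on b {..<n}"
  shows "det (mat n n (\<lambda>(i, j). poly (P j) (b i))) = (\<Prod>j<n. \<Prod>i<j. b j - b i)"
  using assms(3)
proof (induction n)
  case 0
  show ?case by (simp add: det_def)
next
  case (Suc n)
  define A where "A x = mat (Suc n) (Suc n) (\<lambda>(i, j). poly (P j) (if i < n then b i else x))" for x
  define C where "C j = cofactor (A 0) n j" for j
  define Q where "Q = (\<Sum>j\<le>n. smult (C j) (P j))"
  have A: "A x \<in> carrier_mat (Suc n) (Suc n)" for x by (simp add: A_def)
  \<comment> \<open>Deleting the last row removes \<open>x\<close>, so the cofactors are
    constants.\<close>
  have C: "cofactor (A x) n j = C j" if "j \<le> n" for x j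
  proof -
    have "mat_delete (A x) n j = mat_delete (A 0) n j"
      using that by (intro eq_matI) (auto simp: mat_delete_def A_def)
    then show ?thesis by (simp add: cofactor_def C_def)
  qed
  have Q: "poly Q x = det (A x)" for x
  proof -
    have "det (A x) = (\<Sum>j<Suc n. A x $$ (n, j) * cofactor (A x) n j)"
      by (rule laplace_expansion_row[OF A]) simp
    also have "\<dots> = (\<Sum>j\<le>n. C j * poly (P j) x)"
      unfolding lessThan_Suc_atMost
    proof (rule sum.cong[OF refl])
      fix j assume "j \<in> {..n}"
      then show "A x $$ (n, j) * cofactor (A x) n j = C j * poly (P j) x"
        using C[of j x] by (simp add: A_def)
    qed
    finally show ?thesis by (simp add: Q_def poly_sum)
  qed
  have root: "poly Q (b i) = 0" if "i < n" for i
    unfolding Q using that A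
    by (intro det_identical_rows[OF A, of i n]) (auto simp: A_def row_def)
  have inj: "inj_on b {..<n}" using Suc.prems by (auto simp: inj_on_def)
  have "C n = det (mat n n (\<lambda>(i, j). poly (P j) (b i)))"
  proof -
    have "mat_delete (A 0) n n = mat n n (\<lambda>(i, j). poly (P j) (b i))"
      by (intro eq_matI) (auto simp: mat_delete_def A_def)
    then show ?thesis by (simp add: C_def cofactor_def)
  qed
  then have C_n: "C n = (\<Prod>j<n. \<Prod>i<j. b j - b i)" using Suc.IH[OF inj] by simp
  have "Q = smult (C n) (\<Prod>i<n. [:- b i, 1:])"
  proof (rule poly_eqI_degree_lead_coeff[where n = n and A = "b ` {..<n}"])
    have "coeff (smult (C j) (P j)) n = (if j = n then C n else 0)" if "j \<le> n" for j
    proof (cases "j = n")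
      case True
      then show ?thesis using assms(1,2)[of n] by simp
    next
      case False
      then show ?thesis using that assms(1)[of j] by (simp add: coeff_eq_0)
    qed
    then have "coeff Q n = C n"
      by (simp add: Q_def coeff_sum)
    moreover have "coeff (\<Prod>i<n. [:- b i, 1:]) n = 1"
    proof -
      have "degree (\<Prod>i<n. [:- b i, 1:]) = n" by (subst degree_prod_sum_eq) auto
      moreover have "lead_coeff (\<Prod>i<n. [:- b i, 1:]) = 1" by (simp add: lead_coeff_prod)
      ultimately show ?thesis by metis
    qed
    ultimately show "coeff Q n = coeff (smult (C n) (\<Prod>i<n. [:- b i, 1:])) n" by simp
    show "n \<le> card (b ` {..<n})" using inj by (simp add: card_image)
    show "degree Q \<le> n"
      unfolding Q_def by (rule degree_sum_le) (auto intro: order_trans[OF degree_smult_le] simp: assms(1))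
    show "degree (smult (C n) (\<Prod>i<n. [:- b i, 1:])) \<le> n"
      by (rule order_trans[OF degree_smult_le], subst degree_prod_sum_eq) auto
    show "poly Q z = poly (smult (C n) (\<Prod>i<n. [:- b i, 1:])) z" if "z \<in> b ` {..<n}" for z
      using that root by (auto simp: poly_prod)
  qed
  then have "poly Q (b n) = C n * (\<Prod>i<n. b n - b i)" by (simp add: poly_prod)
  moreover have "A (b n) = mat (Suc n) (Suc n) (\<lambda>(i, j). poly (P j) (b i))"
    by (intro eq_matI) (auto simp: A_def less_Suc_eq)
  ultimately show ?case using Q[of "b n"] C_n by simp
qed

section \<open>The theorems of Cauchy--Davenport and Dias da Silva--Hamidoune\<close>

text \<open>For prime \<open>p\<close>, membership in the maximal ideal of the integers localised at
  \<open>p\<close>: the weights and inverse factorials are rational, yet congruences modulo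
  \<open>p\<close> still make sense.\<close>

definition dvd_locally :: "int \<Rightarrow> rat \<Rightarrow> bool" where
  "dvd_locally p r \<longleftrightarrow> (\<exists>u v. \<not> p dvd v \<and> r * of_int v = of_int (p * u))"

lemma dvd_locally_of_int:
  assumes "prime p"
  shows "dvd_locally p (of_int n) \<longleftrightarrow> p dvd n"
proof
  assume "dvd_locally p (of_int n)"
  then obtain u v where uv: "\<not> p dvd v" "(of_int n * of_int v :: rat) = of_int (p * u)"
    by (auto simp: dvd_locally_def)
  then have "n * v = p * u" unfolding of_int_mult[symmetric] of_int_eq_iff by simp
  then have "p dvd n * v" by simp
  then show "p dvd n" using uv(1) prime_dvd_multD[OF assms] by blast
next
  assume "p dvd n"
  then obtain u where "n = p * u" by blast
  then show "dvd_locally p (of_int n)"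
    unfolding dvd_locally_def using assms not_prime_unit[of p] by (intro exI[of _ u] exI[of _ 1]) auto
qed

lemma dvd_locally_divide:
  assumes "p dvd n" "\<not> p dvd w"
  shows "dvd_locally p (of_int n / of_int w)"
proof -
  obtain u where "n = p * u" using assms by blast
  moreover have "w \<noteq> 0" using assms by auto
  ultimately show ?thesis
    unfolding dvd_locally_def using assms by (intro exI[of _ u] exI[of _ w]) auto
qed

lemma dvd_locally_mult:
  assumes "dvd_locally p r"
  shows "dvd_locally p (of_int k * r)"
proof -
  obtain u v where uv: "\<not> p dvd v" "r * of_int v = of_int (p * u)"
    using assms by (auto simp: dvd_locally_def)
  have "of_int k * r * of_int v = of_int (p * (k * u))"
    using uv(2) by (simp add: algebra_simps)
  then show ?thesis using uv(1) unfolding dvd_locally_def by blast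
qed

lemma dvd_locally_add:
  assumes "prime p" "dvd_locally p r" "dvd_locally p s"
  shows "dvd_locally p (r + s)"
proof -
  obtain u v where uv: "\<not> p dvd v" "r * of_int v = of_int (p * u)"
    using assms by (auto simp: dvd_locally_def)
  obtain u' v' where uv': "\<not> p dvd v'" "s * of_int v' = of_int (p * u')"
    using assms by (auto simp: dvd_locally_def)
  have "(r + s) * of_int (v * v') = (r * of_int v) * of_int v' + (s * of_int v') * of_int v"
    by (simp add: algebra_simps)
  also have "\<dots> = of_int (p * (u * v' + u' * v))"
    by (simp only: uv uv') (simp add: algebra_simps)
  finally show ?thesis
    unfolding dvd_locally_def using uv(1) uv'(1) assms(1) prime_dvd_mult_iff[of p v v'] by blast
qed

lemma dvd_locally_sum:
  assumes "prime p" "\<And>x. x \<in> A \<Longrightarrow> dvd_locally p (f x)"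
  shows "dvd_locally p (\<Sum>x\<in>A. f x)"
  using assms(2)
proof (induction A rule: infinite_finite_induct)
  case (insert x A)
  then show ?case by (simp add: dvd_locally_add[OF assms(1)])
qed (use dvd_locally_of_int[OF assms(1), of 0] in auto)


text \<open>
  The polynomial method of Alon, Nathanson and Ruzsa.  Working with integer representatives in
  the localisation of the integers at \<open>p\<close> avoids a type for the field with \<open>p\<close> elements.
\<close>

lemma polynomial_method:
  fixes p :: int and A :: "'i \<Rightarrow> int set" and K :: "'k set" and c :: "'k \<Rightarrow> int"
  assumes p: "prime p" and J: "finite J" and C: "finite C"
    and A: "\<And>j. j \<in> J \<Longrightarrow> finite (A j)" "\<And>j. j \<in> J \<Longrightarrow> A j \<noteq> {}"
      "\<And>j. j \<in> J \<Longrightarrow> inj_on (\<lambda>x. x mod p) (A j)"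
    and deg: "\<And>k. k \<in> K \<Longrightarrow> card C + (\<Sum>j\<in>J. e k j) = (\<Sum>j\<in>J. card (A j) - 1)"
    and zero: "\<And>a. a \<in> PiE J A \<Longrightarrow> (\<Sum>k\<in>K. c k * (\<Prod>j\<in>J. a j ^ e k j)) \<noteq> 0 \<Longrightarrow>
      \<exists>x\<in>C. p dvd (\<Sum>j\<in>J. a j) - x"
  shows "dvd_locally p (fact (card C) * (\<Sum>k\<in>K. of_int (c k) *
    (\<Prod>j\<in>J. if e k j < card (A j) then 1 / fact (card (A j) - 1 - e k j) else 0)))"
proof -
  \<comment> \<open>The value of \<open>g\<close> at an integer congruent modulo \<open>p\<close> to
    an element of \<open>C\<close> is a multiple of \<open>p\<close>.\<close>
  define g :: "rat poly" where "g = (\<Prod>x\<in>C. [:- of_int x, 1:])"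
  have g: "lead_coeff g = 1" "degree g = card C"
    unfolding g_def by (simp add: lead_coeff_prod, subst degree_prod_sum_eq) auto
  define A' where "A' j = (of_int ` A j :: rat set)" for j
  define w where "w j x = (\<Prod>b\<in>A j - {x}. x - b)" for j x
  have A': "\<And>j. j \<in> J \<Longrightarrow> finite (A' j)" "\<And>j. j \<in> J \<Longrightarrow> A' j \<noteq> {}" "\<And>j. card (A' j) = card (A j)"
    using A by (auto simp: A'_def card_image inj_on_def)
  have w: "nodal_weight (A' j) (of_int x) = of_int (w j x)" for j x
  proof -
    have "A' j - {of_int x} = of_int ` (A j - {x})" by (auto simp: A'_def)
    then show ?thesis by (simp add: nodal_weight_def w_def prod.reindex inj_on_def)
  qed
  \<comment> \<open>Distinct residues in \<open>A j\<close> make the weights units of the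
    localisation.\<close>
  have w_p: "\<not> p dvd w j x" if "j \<in> J" "x \<in> A j" for j x
  proof
    assume "p dvd w j x"
    moreover have "finite (A j - {x})" using A(1)[OF that(1)] by simp
    ultimately obtain b where "b \<in> A j - {x}" "p dvd x - b"
      unfolding w_def using prime_dvd_prod_iff[OF _ p] by metis
    moreover from this have "x mod p = b mod p" by (simp add: mod_eq_dvd_iff)
    ultimately show False using A(3)[OF that(1)] that(2) by (auto dest: inj_onD)
  qed
  have reindex: "(\<Sum>b\<in>PiE J A'. h b) = (\<Sum>a\<in>PiE J A. h (restrict (\<lambda>j. of_int (a j)) J))"
    for h :: "('i \<Rightarrow> rat) \<Rightarrow> rat"
  proof (rule sum.reindex_bij_witness[where i = "\<lambda>a. restrict (\<lambda>j. of_int (a j)) J"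
        and j = "\<lambda>b. restrict (\<lambda>j. \<lfloor>b j\<rfloor>) J"])
    fix b assume "b \<in> PiE J A'"
    then have b: "b \<in> extensional J" "\<And>j. j \<in> J \<Longrightarrow> \<exists>x\<in>A j. b j = of_int x"
      by (auto simp: A'_def PiE_iff)
    have floor: "of_int \<lfloor>b j\<rfloor> = b j" "\<lfloor>b j\<rfloor> \<in> A j" if "j \<in> J" for j
      using b(2)[OF that] by auto
    show eq: "restrict (\<lambda>j. of_int (restrict (\<lambda>j. \<lfloor>b j\<rfloor>) J j)) J = b"
      using b(1) floor by (intro extensionalityI[of _ J]) auto
    show "restrict (\<lambda>j. \<lfloor>b j\<rfloor>) J \<in> PiE J A" using floor by auto
    show "h (restrict (\<lambda>j. of_int (restrict (\<lambda>j. \<lfloor>b j\<rfloor>) J j)) J) = h b" by (simp only: eq)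
  next
    fix a assume a: "a \<in> PiE J A"
    then show "restrict (\<lambda>j. \<lfloor>restrict (\<lambda>j. of_int (a j) :: rat) J j\<rfloor>) J = a"
      by (intro extensionalityI[of _ J]) (auto simp: PiE_iff)
    show "restrict (\<lambda>j. of_int (a j)) J \<in> PiE J A'" using a by (auto simp: A'_def PiE_iff)
  qed
  define T where "T k a = poly g (\<Sum>j\<in>J. of_int (a j)) * (\<Prod>j\<in>J. of_int (a j) ^ e k j / of_int (w j (a j)))" for k a
  have T: "(\<Sum>a\<in>PiE J A. T k a) =
      fact (card C) * (\<Prod>j\<in>J. if e k j < card (A j) then 1 / fact (card (A j) - 1 - e k j) else 0)"
    if "k \<in> K" for k
  proof -
    have "degree g + (\<Sum>j\<in>J. e k j) = (\<Sum>j\<in>J. card (A' j) - 1)"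
      using deg[OF that] by (simp add: g A')
    from sum_PiE_poly_over_nodal_weight[OF J A'(1,2) g(1) this]
    show ?thesis unfolding A'(3) by (simp add: reindex T_def g w)
  qed
  \<comment> \<open>The weighted sum over all tuples is evaluated twice: through coefficients, and
    term by term as a sum of local multiples of \<open>p\<close>.\<close>
  have "fact (card C) * (\<Sum>k\<in>K. of_int (c k) *
    (\<Prod>j\<in>J. if e k j < card (A j) then 1 / fact (card (A j) - 1 - e k j) else 0)) =
    (\<Sum>k\<in>K. of_int (c k) * (\<Sum>a\<in>PiE J A. T k a))" (is "?L = _")
    unfolding sum_distrib_left[of "fact (card C)"]
  proof (rule sum.cong[OF refl])
    fix k assume "k \<in> K"
    show "fact (card C) * (of_int (c k) * (\<Prod>j\<in>J. if e k j < card (A j) then 1 / fact (card (A j) - 1 - e k j) else 0)) =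
        of_int (c k) * (\<Sum>a\<in>PiE J A. T k a)"
      unfolding T[OF \<open>k \<in> K\<close>] by (rule mult.left_commute)
  qed
  also have "\<dots> = (\<Sum>a\<in>PiE J A. \<Sum>k\<in>K. of_int (c k) * T k a)"
    unfolding sum_distrib_left by (rule sum.swap)
  also have "dvd_locally p \<dots>"
  proof (rule dvd_locally_sum[OF p])
    fix a assume a: "a \<in> PiE J A"
    define N where "N = (\<Prod>x\<in>C. (\<Sum>j\<in>J. a j) - x) * (\<Sum>k\<in>K. c k * (\<Prod>j\<in>J. a j ^ e k j))"
    have eq: "(\<Sum>k\<in>K. of_int (c k) * T k a) = of_int N / of_int (\<Prod>j\<in>J. w j (a j))"
    proof -
      have "(\<Sum>k\<in>K. of_int (c k) * T k a) = (\<Sum>k\<in>K. of_int ((\<Prod>x\<in>C. (\<Sum>j\<in>J. a j) - x) *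
          (c k * (\<Prod>j\<in>J. a j ^ e k j))) / of_int (\<Prod>j\<in>J. w j (a j)))"
        by (intro sum.cong refl) (simp add: T_def g_def poly_prod prod_dividef)
      then show ?thesis
        by (simp only: N_def sum_distrib_left of_int_sum sum_divide_distrib)
    qed
    \<comment> \<open>Either the multiplier vanishes at \<open>a\<close>, or the sum of
      \<open>a\<close> meets \<open>C\<close> modulo \<open>p\<close> and a factor of
      \<open>g\<close> is divisible by \<open>p\<close>.\<close>
    have "p dvd N"
    proof (cases "(\<Sum>k\<in>K. c k * (\<Prod>j\<in>J. a j ^ e k j)) = 0")
      case False
      then obtain x where "x \<in> C" "p dvd (\<Sum>j\<in>J. a j) - x" using zero[OF a] by blast
      then have "p dvd (\<Prod>x\<in>C. (\<Sum>j\<in>J. a j) - x)"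
        using dvd_prodI[OF C, of x "\<lambda>x. (\<Sum>j\<in>J. a j) - x"] dvd_trans by blast
      then show ?thesis by (simp add: N_def)
    qed (simp add: N_def)
    moreover have "\<not> p dvd (\<Prod>j\<in>J. w j (a j))"
      using a w_p by (auto simp: prime_dvd_prod_iff[OF J p])
    ultimately show "dvd_locally p (\<Sum>k\<in>K. of_int (c k) * T k a)"
      unfolding eq by (rule dvd_locally_divide)
  qed
  finally show ?thesis .
qed

section \<open>The Cauchy--Davenport theorem for families\<close>

lemma exists_le_sum_eq:
  fixes m :: "'i \<Rightarrow> nat"
  assumes "finite J" "N \<le> sum m J"
  shows "\<exists>m'. (\<forall>j. m' j \<le> m j) \<and> sum m' J = N"
  using assms
proof (induction J arbitrary: N rule: finite_induct)
  case empty
  then show ?case by (intro exI[of _ "\<lambda>_. 0"]) auto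
next
  case (insert x J)
  have "N - min N (m x) \<le> sum m J" using insert by auto
  then obtain m' where m': "\<forall>j. m' j \<le> m j" "sum m' J = N - min N (m x)"
    using insert.IH by blast
  have "sum (m'(x := min N (m x))) J = sum m' J"
    using insert.hyps by (intro sum.cong) auto
  then show ?case using m' insert.hyps by (intro exI[of _ "m'(x := min N (m x))"]) auto
qed

text \<open>If the residue of \<open>z\<close> were missed, all sums would lie in
  \<open>p - 1\<close> classes, and the polynomial method with constant multiplier would make
  \<open>p\<close> divide \<open>fact (p - 1)\<close>.\<close>

lemma cauchy_davenport_family:
  fixes p :: nat and X :: "'i \<Rightarrow> int set"
  assumes p: "prime p" and J: "finite J"
    and X: "\<And>j. j \<in> J \<Longrightarrow> finite (X j)"
      "\<And>j. j \<in> J \<Longrightarrow> m j < card ((\<lambda>x. x mod int p) ` X j)"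
    and m: "p - 1 \<le> sum m J"
  shows "\<exists>x. (\<forall>j\<in>J. x j \<in> X j) \<and> (\<Sum>j\<in>J. x j) mod int p = z mod int p"
proof (rule ccontr)
  assume contra: "\<not> ?thesis"
  \<comment> \<open>The polynomial method needs matching degrees, hence bounds of total exactly
    \<open>p - 1\<close> and sets of size exactly \<open>Suc (m' j)\<close>.\<close>
  obtain m' where m': "\<And>j. m' j \<le> m j" "sum m' J = p - 1"
    using exists_le_sum_eq[OF J m] by blast
  have "\<exists>Y. Y \<subseteq> X j \<and> inj_on (\<lambda>x. x mod int p) Y \<and> card Y = Suc (m' j)" if j: "j \<in> J" for j
  proof -
    have "Suc (m' j) \<le> card ((\<lambda>x. x mod int p) ` X j)"
      using X(2)[OF j] m'(1)[of j] by linarith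
    then obtain Z where Z: "Z \<subseteq> (\<lambda>x. x mod int p) ` X j" "card Z = Suc (m' j)"
      using obtain_subset_with_card_n by metis
    then obtain Y where "Y \<subseteq> X j" "Z = (\<lambda>x. x mod int p) ` Y" "inj_on (\<lambda>x. x mod int p) Y"
      by (auto simp: subset_image_inj)
    then show ?thesis using Z card_image by metis
  qed
  then obtain Y where Y: "\<And>j. j \<in> J \<Longrightarrow> Y j \<subseteq> X j" "\<And>j. j \<in> J \<Longrightarrow> inj_on (\<lambda>x. x mod int p) (Y j)"
    "\<And>j. j \<in> J \<Longrightarrow> card (Y j) = Suc (m' j)"
    by metis
  have fin: "finite (Y j)" "Y j \<noteq> {}" if "j \<in> J" for j
    using Y(1,3)[OF that] X(1)[OF that] finite_subset by auto
  have p': "prime (int p)" and p0: "int p > 0" using p prime_gt_0_nat by auto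
  define C where "C = {0..<int p} - {z mod int p}"
  have C: "finite C" "card C = p - 1"
    using p0 by (auto simp: C_def card_Diff_subset)
  have "dvd_locally (int p) (fact (card C) * (\<Sum>k\<in>{()}. of_int 1 *
    (\<Prod>j\<in>J. if 0 < card (Y j) then 1 / fact (card (Y j) - 1 - 0) else 0)))"
  proof (rule polynomial_method[OF p' J C(1) fin Y(2)])
    show "card C + (\<Sum>j\<in>J. 0) = (\<Sum>j\<in>J. card (Y j) - 1)"
      using m'(2) C(2) Y(3) by simp
    fix a assume a: "a \<in> PiE J Y"
    have "(\<Sum>j\<in>J. a j) mod int p \<noteq> z mod int p"
      using contra a Y(1) by (metis PiE_mem subsetD)
    then show "\<exists>x\<in>C. int p dvd (\<Sum>j\<in>J. a j) - x"
      using p0 by (intro bexI[of _ "(\<Sum>j\<in>J. a j) mod int p"]) (auto simp: C_def)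
  qed auto
  moreover have "(\<Prod>j\<in>J. if 0 < card (Y j) then 1 / fact (card (Y j) - 1 - 0) else (0::rat)) =
      (\<Prod>j\<in>J. 1 / of_int (fact (m' j)))"
    using Y(3) by (intro prod.cong) auto
  ultimately have "dvd_locally (int p) (fact (p - 1) * (\<Prod>j\<in>J. 1 / of_int (fact (m' j))))"
    by (simp add: C)
  then have "dvd_locally (int p) (of_int (\<Prod>j\<in>J. fact (m' j)) * (fact (p - 1) * (\<Prod>j\<in>J. 1 / of_int (fact (m' j)))))"
    by (rule dvd_locally_mult)
  also have "of_int (\<Prod>j\<in>J. fact (m' j)) * (fact (p - 1) * (\<Prod>j\<in>J. 1 / of_int (fact (m' j)))) = (of_int (fact (p - 1)) :: rat)"
    using J by (simp add: prod_dividef)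
  finally have "int p dvd fact (p - 1)" by (simp only: dvd_locally_of_int[OF p'])
  then have "p dvd fact (p - 1)" by (metis int_dvd_int_iff of_nat_fact)
  then have "p \<le> p - 1" using prime_dvd_fact_iff[OF p] by blast
  then show False using p0 by linarith
qed

section \<open>The Dias da Silva--Hamidoune theorem\<close>

lemma det_poly_eq_sum:
  fixes a :: "nat \<Rightarrow> 'a::idom"
  shows "(\<Sum>\<pi> | \<pi> permutes {0..<t}. of_int (sign \<pi>) * (\<Prod>j=0..<t. poly (P (\<pi> j)) (a j))) =
    det (mat t t (\<lambda>(i, j). poly (P j) (a i)))"
  by (subst det_def') (auto intro!: sum.cong prod.cong simp: sign_def permutes_in_image)

text \<open>The sum is a monomial times a Vandermonde determinant. As a multiplier it restricts the
  polynomial method to tuples of distinct elements.\<close>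

lemma sum_signed_powers_eq_0:
  fixes a :: "nat \<Rightarrow> int"
  assumes "\<not> inj_on a {0..<t}"
  shows "(\<Sum>\<pi> | \<pi> permutes {0..<t}. sign \<pi> * (\<Prod>j=0..<t. a j ^ (e j + \<pi> j))) = 0"
proof -
  obtain i j where ij: "i < t" "j < t" "i \<noteq> j" "a i = a j"
    using assms by (auto simp: inj_on_def)
  have "det (mat t t (\<lambda>(i, j). poly (monom 1 j) (a i))) = 0"
    using ij by (intro det_identical_rows[of _ t i j]) (auto simp: row_def)
  then have "(\<Sum>\<pi> | \<pi> permutes {0..<t}. sign \<pi> * (\<Prod>j=0..<t. a j ^ \<pi> j)) = 0"
    using det_poly_eq_sum[where t = t and P = "\<lambda>k. monom 1 k" and a = a] by (simp add: poly_monom)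
  then have "(\<Prod>j=0..<t. a j ^ e j) * (\<Sum>\<pi> | \<pi> permutes {0..<t}. sign \<pi> * (\<Prod>j=0..<t. a j ^ \<pi> j)) = 0"
    by simp
  then show ?thesis
    by (simp only: sum_distrib_left power_add prod.distrib mult.left_commute)
qed

definition falling_poly :: "nat \<Rightarrow> 'a::idom poly" where
  "falling_poly k = (\<Prod>i<k. [:- of_nat i, 1:])"

lemma degree_falling_poly: "degree (falling_poly k) = k"
  unfolding falling_poly_def by (subst degree_prod_sum_eq) auto

lemma lead_coeff_falling_poly: "lead_coeff (falling_poly k) = 1"
  unfolding falling_poly_def by (simp add: lead_coeff_prod)

text \<open>Turns inverse factorials, with value \<open>0\<close> for \<open>k > b\<close>, into
  monic polynomials in \<open>b\<close>, to which \<open>det_monic_polys\<close> applies.\<close>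

lemma poly_falling_poly:
  "poly (falling_poly k) (of_nat b :: 'a::field_char_0) / fact b = (if k \<le> b then 1 / fact (b - k) else 0)"
proof (cases "k \<le> b")
  case True
  then have "poly (falling_poly k) (of_nat b :: 'a) * fact (b - k) = fact b"
  proof (induction k)
    case 0
    show ?case by (simp add: falling_poly_def)
  next
    case (Suc k)
    have "poly (falling_poly (Suc k)) (of_nat b :: 'a) * fact (b - Suc k) =
        poly (falling_poly k) (of_nat b) * (of_nat (b - k) * fact (b - Suc k))"
      using Suc.prems by (simp add: falling_poly_def of_nat_diff algebra_simps)
    also have "of_nat (b - k) * fact (b - Suc k) = (fact (b - k) :: 'a)"
      using Suc.prems by (subst (2) fact_reduce) auto
    finally show ?case using Suc by simp
  qed
  then show ?thesis using True by (simp add: field_simps)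
next
  case False
  then have "poly (falling_poly k) (of_nat b :: 'a) = 0"
    by (auto simp: falling_poly_def poly_prod intro!: prod_zero bexI[of _ b])
  then show ?thesis using False by simp
qed

text \<open>If at most \<open>M\<close> residues occurred, the polynomial method with a Vandermonde
  multiplier would make \<open>p\<close> divide \<open>fact M\<close> times the differences of
  certain distinct integers \<open>b j\<close> below \<open>p\<close>, which is impossible as
  \<open>M < p\<close>.\<close>

lemma dias_da_silva_hamidoune:
  fixes p :: nat and A :: "int set"
  assumes p: "prime p" and A: "finite A" and inj: "inj_on (\<lambda>x. x mod int p) A"
    and t: "t \<le> card A" and M: "M \<le> t * (card A - t)" "M < p"
  shows "M < card ((\<lambda>I. \<Sum>I mod int p) ` {I. I \<subseteq> A \<and> card I = t})"
proof (rule ccontr)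
  define R where "R = (\<lambda>I. \<Sum>I mod int p) ` {I. I \<subseteq> A \<and> card I = t}"
  define n where "n = card A"
  assume "\<not> M < card ((\<lambda>I. \<Sum>I mod int p) ` {I. I \<subseteq> A \<and> card I = t})"
  then have card_R: "card R \<le> M" by (simp add: R_def)
  have fin_R: "finite R" unfolding R_def by (rule finite_imageI, rule finite_subset[OF _ finite_Pow_iff[THEN iffD2, OF A]]) auto
  have p': "prime (int p)" and p0: "int p > 0" using p prime_gt_0_nat by auto
  \<comment> \<open>For \<open>t = 0\<close> the empty subset already supplies a residue, while
    \<open>M = 0\<close>.\<close>
  have t0: "t \<noteq> 0"
  proof
    assume "t = 0"
    then have "{} \<in> {I. I \<subseteq> A \<and> card I = t}" by simp
    then have "R \<noteq> {}" unfolding R_def by blast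
    then have "0 < card R" using fin_R by (simp add: card_gt_0_iff)
    then show False using \<open>t = 0\<close> M(1) card_R by simp
  qed
  \<comment> \<open>\<open>R\<close> is padded to exactly \<open>M\<close> elements so that the
    degrees match.\<close>
  obtain C where C: "finite C" "card C = M" "R \<subseteq> C"
  proof -
    obtain D where "finite D" "D \<subseteq> UNIV - R" "card D = M - card R"
      using infinite_arbitrarily_large[of "UNIV - R" "M - card R"] fin_R infinite_UNIV_int
      by (metis Diff_infinite_finite)
    moreover from this have "card (R \<union> D) = M"
      using fin_R card_R by (subst card_Un_disjoint) auto
    ultimately show ?thesis using fin_R that[of "R \<union> D"] by auto
  qed
  have n_le: "n \<le> p"
  proof -
    have "n = card ((\<lambda>x. x mod int p) ` A)" using inj by (simp add: n_def card_image)
    also have "\<dots> \<le> card {0..<int p}" by (rule card_mono) (use p0 in auto)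
    finally show ?thesis by simp
  qed
  define u v where "u = M div t" and "v = M mod t"
  have uv: "M = t * u + v" "v < t" using t0 by (auto simp: u_def v_def)
  \<comment> \<open>The exponents are chosen such that \<open>b\<close> is strictly increasing below \<open>n\<close> with sum
    \<open>t * (t - 1) / 2 + M\<close>; the relevant coefficient is then a Vandermonde product of the \<open>b j\<close>,
    up to factorials.\<close>
  define b where "b j = j + u + (if t - v \<le> j then 1 else 0)" for j
  have b_mono: "b i < b j" if "i < j" for i j
    using that by (auto simp: b_def)
  have b_eq: "b i = b j \<longleftrightarrow> i = j" for i j
    using b_mono[of i j] b_mono[of j i] by (cases i j rule: linorder_cases) auto
  \<comment> \<open>A remainder \<open>v > 0\<close> forces \<open>u < n - t\<close>, leaving room
    for the extra unit in the last \<open>v\<close> entries.\<close>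
  have b_less: "b j < n" if "j < t" for j
  proof -
    have "u \<le> n - t" using M(1) uv t0 unfolding n_def by (metis div_le_mono nonzero_mult_div_cancel_left u_def)
    moreover have "u < n - t" if "v > 0"
    proof -
      have "t * u < t * (n - t)" using that M(1) uv(1) unfolding n_def by linarith
      then show ?thesis by simp
    qed
    ultimately show ?thesis using \<open>j < t\<close> t uv(2) by (cases "v = 0") (auto simp: b_def n_def)
  qed
  have sum_b: "(\<Sum>j=0..<t. b j) = (\<Sum>j=0..<t. j) + M"
  proof -
    have "(\<Sum>j=0..<t. if t - v \<le> j then 1 else 0) = card ({0..<t} \<inter> {j. t - v \<le> j})"
      by (simp add: sum.If_cases)
    also have "{0..<t} \<inter> {j. t - v \<le> j} = {t - v..<t}" by auto
    finally have "(\<Sum>j=0..<t. if t - v \<le> j then 1 else 0) = v" using uv(2) by simp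
    then show ?thesis by (simp add: b_def sum.distrib uv(1))
  qed
  \<comment> \<open>Exponents of the Vandermonde terms after multiplication by the monomial with
    exponents \<open>n - 1 - b j\<close>; for \<open>\<pi> j \<le> b j\<close> the factorial in the
    coefficient is then that of \<open>b j - \<pi> j\<close>.\<close>
  define e where "e \<pi> j = n - 1 - b j + \<pi> j" for \<pi> :: "nat \<Rightarrow> nat" and j
  define K where "K = {\<pi>. \<pi> permutes {0..<t}}"
  have "dvd_locally (int p) (fact (card C) * (\<Sum>\<pi>\<in>K. of_int (sign \<pi>) *
    (\<Prod>j\<in>{0..<t}. if e \<pi> j < card A then 1 / fact (card A - 1 - e \<pi> j) else 0)))"
  proof (rule polynomial_method[OF p' _ C(1)])
    show "A \<noteq> {}" using t t0 by auto
    fix \<pi> assume "\<pi> \<in> K"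
    then have "(\<Sum>j=0..<t. \<pi> j) = (\<Sum>j=0..<t. j)"
      using sum.permute[of \<pi> "{0..<t}" "\<lambda>j. j"] by (simp add: K_def comp_def)
    moreover have "(\<Sum>j=0..<t. n - 1 - b j) + (\<Sum>j=0..<t. b j) = (\<Sum>j=0..<t. n - 1)"
      using b_less by (subst sum.distrib[symmetric], intro sum.cong) fastforce+
    ultimately show "card C + (\<Sum>j\<in>{0..<t}. e \<pi> j) = (\<Sum>j\<in>{0..<t}. card A - 1)"
      unfolding n_def[symmetric] using sum_b C(2) by (simp add: e_def sum.distrib)
  next
    fix a assume a: "a \<in> {0..<t} \<rightarrow>\<^sub>E A" and nz: "(\<Sum>\<pi>\<in>K. sign \<pi> * (\<Prod>j\<in>{0..<t}. a j ^ e \<pi> j)) \<noteq> 0"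
    have "inj_on a {0..<t}"
      using sum_signed_powers_eq_0[of a t "\<lambda>j. n - 1 - b j"] nz by (auto simp: K_def e_def)
    then have "card (a ` {0..<t}) = t" "\<Sum>(a ` {0..<t}) = (\<Sum>j\<in>{0..<t}. a j)"
      by (simp_all add: card_image sum.reindex)
    then have "(\<Sum>j\<in>{0..<t}. a j) mod int p \<in> R"
      unfolding R_def using a by (intro image_eqI[of _ _ "a ` {0..<t}"]) auto
    then show "\<exists>x\<in>C. int p dvd (\<Sum>j\<in>{0..<t}. a j) - x"
      using C(3) by (intro bexI[of _ "(\<Sum>j\<in>{0..<t}. a j) mod int p"]) auto
  qed (use A inj in auto)
  also have "(\<Sum>\<pi>\<in>K. of_int (sign \<pi>) * (\<Prod>j\<in>{0..<t}. if e \<pi> j < card A then 1 / fact (card A - 1 - e \<pi> j) else 0)) =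
    (\<Sum>\<pi>\<in>K. of_int (sign \<pi>) * (\<Prod>j\<in>{0..<t}. poly (falling_poly (\<pi> j)) (of_nat (b j)) / (fact (b j) :: rat)))"
  proof (intro sum.cong prod.cong refl arg_cong2[where f = "(*)"])
    fix \<pi> j assume "j \<in> {0..<t}"
    then have "b j < n" using b_less by simp
    then have "e \<pi> j < card A \<longleftrightarrow> \<pi> j \<le> b j" "card A - 1 - e \<pi> j = b j - \<pi> j"
      unfolding n_def[symmetric] by (auto simp: e_def)
    then show "(if e \<pi> j < card A then 1 / fact (card A - 1 - e \<pi> j) else 0) =
        poly (falling_poly (\<pi> j)) (of_nat (b j)) / (fact (b j) :: rat)"
      by (simp add: poly_falling_poly)
  qed
  also have "\<dots> = (\<Sum>\<pi>\<in>K. of_int (sign \<pi>) * (\<Prod>j\<in>{0..<t}. poly (falling_poly (\<pi> j)) (of_nat (b j)))) / (\<Prod>j\<in>{0..<t}. fact (b j))"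
    by (simp add: prod_dividef sum_divide_distrib)
  also have "(\<Sum>\<pi>\<in>K. of_int (sign \<pi>) * (\<Prod>j\<in>{0..<t}. poly (falling_poly (\<pi> j)) (of_nat (b j)))) =
      (\<Prod>j<t. \<Prod>i<j. of_nat (b j) - of_nat (b i) :: rat)"
    unfolding K_def det_poly_eq_sum[where P = falling_poly and a = "\<lambda>j. of_nat (b j)"]
    by (intro det_monic_polys degree_falling_poly lead_coeff_falling_poly)
      (auto simp: inj_on_def b_eq)
  finally have "dvd_locally (int p) (fact M * ((\<Prod>j<t. \<Prod>i<j. of_nat (b j) - of_nat (b i)) / (\<Prod>j\<in>{0..<t}. fact (b j))))"
    by (simp add: C(2))
  then have "dvd_locally (int p) (of_int (\<Prod>j\<in>{0..<t}. fact (b j)) *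
      (fact M * ((\<Prod>j<t. \<Prod>i<j. of_nat (b j) - of_nat (b i)) / (\<Prod>j\<in>{0..<t}. fact (b j)))))"
    by (rule dvd_locally_mult)
  also have "of_int (\<Prod>j\<in>{0..<t}. fact (b j)) *
      (fact M * ((\<Prod>j<t. \<Prod>i<j. of_nat (b j) - of_nat (b i)) / (\<Prod>j\<in>{0..<t}. fact (b j)))) =
      (of_int (fact M * (\<Prod>j<t. \<Prod>i<j. int (b j) - int (b i))) :: rat)"
    by simp
  finally have "int p dvd fact M * (\<Prod>j<t. \<Prod>i<j. int (b j) - int (b i))"
    by (simp only: dvd_locally_of_int[OF p'])
  moreover have "\<not> int p dvd fact M"
    using prime_dvd_fact_iff[OF p] M(2) by (metis int_dvd_int_iff not_le of_nat_fact)
  moreover have "\<not> int p dvd (\<Prod>j<t. \<Prod>i<j. int (b j) - int (b i))"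
  proof
    assume "int p dvd (\<Prod>j<t. \<Prod>i<j. int (b j) - int (b i))"
    then obtain i j where ij: "i < j" "j < t" "int p dvd int (b j) - int (b i)"
      by (auto simp: prime_dvd_prod_iff[OF _ p'])
    then show False using b_mono[OF ij(1)] b_less[OF ij(2)] n_le zdvd_imp_le[OF ij(3)] by linarith
  qed
  ultimately show False using prime_dvd_multD[OF p'] by blast
qed

section \<open>Distributing the summands among the residue classes\<close>

text \<open>Cauchy--Davenport for the progressions \<open>0, f, ..., c f * f\<close>; invertibility
  of \<open>f\<close> keeps up to \<open>p\<close> consecutive terms distinct modulo
  \<open>p\<close>.\<close>

lemma exists_multiples_sum:
  fixes p :: nat and c :: "nat \<Rightarrow> nat"
  assumes p: "prime p" and c: "p - 1 \<le> (\<Sum>f\<in>{1..<p}. c f)"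
  shows "\<exists>j. (\<forall>f\<in>{1..<p}. j f \<le> c f) \<and> (\<Sum>f\<in>{1..<p}. int (j f) * int f) mod int p = z mod int p"
proof -
  \<comment> \<open>The cap keeps the multiples distinct modulo \<open>p\<close>; a single term that
    reaches it already suffices for the total.\<close>
  define m where "m f = min (p - 1) (c f)" for f
  define X where "X f = (\<lambda>j. int j * int f) ` {..c f}" for f
  have p1: "p > 1" using p by (rule prime_gt_1_nat)
  have "p - 1 \<le> (\<Sum>f\<in>{1..<p}. m f)"
  proof (cases "\<exists>f\<in>{1..<p}. p - 1 \<le> c f")
    case True
    then obtain f where "f \<in> {1..<p}" "m f = p - 1" by (auto simp: m_def)
    then show ?thesis using member_le_sum[of f "{1..<p}" m] by simp
  next
    case False
    then have "(\<Sum>f\<in>{1..<p}. m f) = (\<Sum>f\<in>{1..<p}. c f)"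
      by (intro sum.cong) (auto simp: m_def min_def)
    then show ?thesis using c by simp
  qed
  moreover have "m f < card ((\<lambda>x. x mod int p) ` X f)" if f: "f \<in> {1..<p}" for f
  proof -
    have "inj_on (\<lambda>j. int j * int f mod int p) {..m f}"
    proof (rule inj_onI)
      fix i j assume ij: "i \<in> {..m f}" "j \<in> {..m f}" "int i * int f mod int p = int j * int f mod int p"
      then have "int p dvd (int i - int j) * int f"
        by (simp add: mod_eq_dvd_iff left_diff_distrib)
      moreover have "\<not> int p dvd int f"
        using f by (auto dest!: zdvd_imp_le)
      moreover have "prime (int p)" using p by simp
      ultimately have "int p dvd int i - int j" using prime_dvd_multD by blast
      moreover have "\<bar>int i - int j\<bar> < int p" using ij p1 by (auto simp: m_def)
      ultimately show "i = j" using dvd_imp_le_int[of "int i - int j" "int p"] by fastforce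
    qed
    then have "card ((\<lambda>j. int j * int f mod int p) ` {..m f}) = Suc (m f)"
      by (simp add: card_image)
    moreover have "card ((\<lambda>j. int j * int f mod int p) ` {..m f}) \<le> card ((\<lambda>x. x mod int p) ` X f)"
      by (rule card_mono) (auto simp: X_def m_def image_image)
    ultimately show ?thesis by simp
  qed
  moreover have "finite (X f)" for f by (simp add: X_def)
  ultimately have "\<exists>x. (\<forall>f\<in>{1..<p}. x f \<in> X f) \<and> (\<Sum>f\<in>{1..<p}. x f) mod int p = z mod int p"
    by (intro cauchy_davenport_family[OF p, where m = m]) simp_all
  then obtain x where x: "\<And>f. f \<in> {1..<p} \<Longrightarrow> x f \<in> X f" "(\<Sum>f\<in>{1..<p}. x f) mod int p = z mod int p"
    by blast
  have "\<exists>j\<le>c f. x f = int j * int f" if "f \<in> {1..<p}" for f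
    using x(1)[OF that] by (auto simp: X_def)
  then obtain j where j: "\<And>f. f \<in> {1..<p} \<Longrightarrow> j f \<le> c f \<and> x f = int (j f) * int f"
    by metis
  then have "(\<Sum>f\<in>{1..<p}. int (j f) * int f) = (\<Sum>f\<in>{1..<p}. x f)"
    by (intro sum.cong) auto
  then have "(\<Sum>f\<in>{1..<p}. int (j f) * int f) mod int p = z mod int p" using x(2) by argo
  then show ?thesis using j by blast
qed

text \<open>Adjoining \<open>0\<close> turns sums of at most \<open>t\<close> terms into sums of exactly \<open>t\<close> terms.\<close>

lemma exists_subset_sum:
  fixes p t :: nat
  assumes p: "prime p" and F: "F \<subseteq> {1..<p}" and t: "t \<le> card F + 1" "p - 1 \<le> t * (card F + 1 - t)"
  shows "\<exists>I\<subseteq>F. card I \<le> t \<and> (\<Sum>f\<in>I. int f) mod int p = z mod int p"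
proof -
  define A where "A = int ` insert 0 F"
  have p1: "p > 1" using p by (rule prime_gt_1_nat)
  have fin: "finite F" using F finite_subset by blast
  have A: "finite A" "card A = card F + 1"
    using fin F by (auto simp: A_def card_image card_insert_if)
  have mod_A: "x mod int p = x" if "x \<in> A" for x
    using that F p1 by (auto simp: A_def)
  have inj: "inj_on (\<lambda>x. x mod int p) A"
  proof (rule inj_onI)
    fix x y assume "x \<in> A" "y \<in> A" "x mod int p = y mod int p"
    then show "x = y" using mod_A[of x] mod_A[of y] by simp
  qed
  define R where "R = (\<lambda>I. \<Sum>I mod int p) ` {I. I \<subseteq> A \<and> card I = t}"
  have "p - 1 < card R"
    unfolding R_def using t p1 by (intro dias_da_silva_hamidoune[OF p A(1) inj]) (auto simp: A)
  moreover have "R \<subseteq> {0..<int p}" using p1 by (auto simp: R_def)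
  ultimately have "R = {0..<int p}"
    by (intro card_seteq) auto
  then have "z mod int p \<in> R" using p1 by simp
  then obtain I where I: "I \<subseteq> A" "card I = t" "\<Sum>I mod int p = z mod int p"
    by (auto simp: R_def)
  obtain I' where I': "I' \<subseteq> insert 0 F" "I = int ` I'"
    using I(1) unfolding A_def subset_image_iff by blast
  have fin': "finite I'" using I'(1) fin finite_subset by blast
  have "(\<Sum>f\<in>I' - {0}. int f) = (\<Sum>f\<in>I'. int f)"
    using fin' by (intro sum.mono_neutral_left) auto
  also have "\<dots> = \<Sum>I" unfolding I'(2) by (simp add: sum.reindex)
  finally have "(\<Sum>f\<in>I' - {0}. int f) mod int p = z mod int p" using I(3) by simp
  moreover have "card (I' - {0}) \<le> t"
    using I(2) I'(2) card_Diff1_le[of I' 0] by (simp add: card_image)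
  ultimately show ?thesis using I'(1) by (intro exI[of _ "I' - {0}"]) auto
qed

section \<open>Balanced products\<close>

text \<open>The floor of \<open>n * n / 4\<close>, the maximum of \<open>t * (n - t)\<close> over
  integers \<open>t\<close>.\<close>

definition half_prod :: "nat \<Rightarrow> nat" where
  "half_prod n = (n div 2) * (n - n div 2)"

text \<open>The two sides differ by \<open>(t - 1) * (n - t - 1)\<close>.\<close>

lemma le_mult_complement:
  fixes n t :: nat
  assumes "1 \<le> t" "t < n"
  shows "n \<le> t * (n - t) + 1"
proof -
  define a b where "a = t - 1" and "b = n - t - 1"
  have ab: "t = a + 1" "n = a + b + 2" using assms by (auto simp: a_def b_def)
  have "n - t = b + 1" using ab by simp
  then show ?thesis using ab by (simp add: algebra_simps)
qed

lemma half_prod_ge: "n \<le> half_prod n + 1"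
proof (cases "n < 2")
  case True
  then show ?thesis by (auto simp: half_prod_def)
next
  case False
  then show ?thesis unfolding half_prod_def by (intro le_mult_complement) auto
qed

lemma half_prod_even_odd: "half_prod (2 * k) = k * k" "half_prod (2 * k + 1) = k * (k + 1)"
proof -
  have "(2 * k + 1) div 2 = k" "2 * k + 1 - k = k + 1" by auto
  then show "half_prod (2 * k + 1) = k * (k + 1)" by (simp only: half_prod_def)
qed (simp add: half_prod_def mult_2)

lemma half_prod_ge':
  assumes "4 \<le> n"
  shows "n \<le> half_prod n"
proof (cases "even n")
  case True
  then obtain k where k: "n = 2 * k" by (elim evenE)
  then show ?thesis using assms half_prod_even_odd(1)[of k] mult_le_mono1[of 2 k k] by simp
next
  case False
  then obtain k where k: "n = 2 * k + 1" by (elim oddE)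
  have k2: "2 \<le> k" using assms k by presburger
  then have "2 * k \<le> k * k" by (rule mult_le_mono1)
  moreover have "half_prod n = k * k + k" unfolding k half_prod_even_odd by simp
  ultimately show ?thesis using k k2 by linarith
qed

lemma four_half_prod: "n * n \<le> 4 * half_prod n + 1"
proof (cases "even n")
  case True
  then obtain k where k: "n = 2 * k" by (elim evenE)
  then show ?thesis using half_prod_even_odd(1)[of k] by simp
next
  case False
  then obtain k where k: "n = 2 * k + 1" by (elim oddE)
  then show ?thesis using half_prod_even_odd(2)[of k] by (simp add: algebra_simps)
qed

text \<open>An odd \<open>n\<close> has two equally balanced splittings.\<close>

lemma half_prod_shift_odd:
  assumes "odd n"
  shows "(n div 2 + 1) * (n - (n div 2 + 1)) = half_prod n"
proof -
  obtain k where k: "n = 2 * k + 1" using assms by (elim oddE)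
  have "n div 2 = k" "n - (k + 1) = k" using k by auto
  then show ?thesis using half_prod_even_odd(2)[of k] k by simp
qed

lemma half_prod_shift:
  assumes "1 \<le> n"
  shows "half_prod n \<le> (n div 2 + 1) * (n - (n div 2 + 1)) + 1"
proof (cases "even n")
  case True
  then obtain k where k: "n = 2 * k" by (elim evenE)
  then obtain l where l: "k = l + 1" using assms by (cases k) auto
  have "n div 2 = k" "n - (k + 1) = l" using k l by auto
  then show ?thesis using half_prod_even_odd(1)[of k] k l by (simp add: algebra_simps)
next
  case False
  then show ?thesis using half_prod_shift_odd[of n] by simp
qed

text \<open>
  In the following, \<open>n f\<close> is the number of available elements with residue \<open>f\<close>, and \<open>t f\<close> of them
  are to be used.  By the Dias da Silva--Hamidoune theorem the second coordinates of the resulting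
  sums cover everything as soon as the sum of all \<open>t f * (n f - t f)\<close> is at least \<open>q - 1\<close>.
\<close>

definition admissible :: "nat \<Rightarrow> nat \<Rightarrow> (nat \<Rightarrow> nat) \<Rightarrow> int \<Rightarrow> (nat \<Rightarrow> nat) \<Rightarrow> bool" where
  "admissible p q n x t \<longleftrightarrow> (\<forall>f<p. t f \<le> n f) \<and> t 0 = n 0 div 2 \<and>
     (\<Sum>f<p. int (t f) * int f) mod int p = x mod int p \<and> q - 1 \<le> (\<Sum>f<p. t f * (n f - t f))"

lemma sum_lessThan_split_0: "0 < (p::nat) \<Longrightarrow> (\<Sum>f<p. g f) = g 0 + (\<Sum>f\<in>{1..<p}. g f)"
  by (simp add: atLeast0LessThan[symmetric] sum.atLeast_Suc_lessThan)

text \<open>Each \<open>t f\<close> runs from \<open>lo f\<close> to \<open>lo f + c f\<close>, and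
  these intervals are long enough together to reach every residue modulo \<open>p\<close>;
  \<open>d f\<close> bounds the loss of class \<open>f\<close> against \<open>n f\<close>. Class
  \<open>0\<close> contributes nothing modulo \<open>p\<close> and stays balanced.\<close>

lemma admissible_intervalI:
  assumes p: "prime p" and c: "p - 1 \<le> (\<Sum>f\<in>{1..<p}. c f)"
    and le: "\<And>f. f \<in> {1..<p} \<Longrightarrow> lo f + c f \<le> n f"
    and gain: "\<And>f j. f \<in> {1..<p} \<Longrightarrow> j \<le> c f \<Longrightarrow> n f \<le> (lo f + j) * (n f - (lo f + j)) + d f"
    and total: "q - 1 + (\<Sum>f\<in>{1..<p}. d f) \<le> half_prod (n 0) + (\<Sum>f\<in>{1..<p}. n f)"
  shows "\<exists>t. admissible p q n x t"
proof -
  have p0: "p > 0" using p prime_gt_0_nat by simp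
  obtain j where j: "\<And>f. f \<in> {1..<p} \<Longrightarrow> j f \<le> c f"
    "(\<Sum>f\<in>{1..<p}. int (j f) * int f) mod int p = (x - (\<Sum>f\<in>{1..<p}. int (lo f) * int f)) mod int p"
    using exists_multiples_sum[OF p c] by blast
  define t where "t f = (if f = 0 then n 0 div 2 else lo f + j f)" for f
  have "admissible p q n x t"
    unfolding admissible_def
  proof (intro conjI allI impI)
    fix f assume "f < p"
    then show "t f \<le> n f" using j(1)[of f] le[of f] by (cases "f = 0") (auto simp: t_def)
  next
    have "(\<Sum>f<p. int (t f) * int f) = (\<Sum>f\<in>{1..<p}. int (lo f + j f) * int f)"
      unfolding sum_lessThan_split_0[OF p0] by (auto simp: t_def intro!: sum.cong)
    also have "\<dots> = (\<Sum>f\<in>{1..<p}. int (lo f) * int f) + (\<Sum>f\<in>{1..<p}. int (j f) * int f)"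
      by (simp add: algebra_simps sum.distrib)
    also have "\<dots> mod int p = x mod int p"
      using mod_add_cong[OF refl j(2), of "\<Sum>f\<in>{1..<p}. int (lo f) * int f"] by simp
    finally show "(\<Sum>f<p. int (t f) * int f) mod int p = x mod int p" .
  next
    have "(\<Sum>f\<in>{1..<p}. n f) \<le> (\<Sum>f\<in>{1..<p}. t f * (n f - t f) + d f)"
      using gain j(1) by (intro sum_mono) (auto simp: t_def)
    moreover have "t 0 * (n 0 - t 0) = half_prod (n 0)" by (simp add: t_def half_prod_def)
    ultimately show "q - 1 \<le> (\<Sum>f<p. t f * (n f - t f))"
      unfolding sum_lessThan_split_0[OF p0] using total by (simp add: sum.distrib)
  qed (simp add: t_def)
  then show ?thesis by blast
qed

text \<open>Starting from the balanced choice, each class in \<open>I\<close> gets one more summand;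
  only the even classes pay for it, one unit each.\<close>

lemma admissible_shiftI:
  assumes p: "prime p" and I: "I \<subseteq> {1..<p}" "\<And>f. f \<in> I \<Longrightarrow> 1 \<le> n f"
    and x: "(\<Sum>f\<in>I. int f) mod int p = (x - (\<Sum>f<p. int (n f div 2) * int f)) mod int p"
    and total: "q - 1 + card {f\<in>I. even (n f)} \<le> (\<Sum>f<p. half_prod (n f))"
  shows "\<exists>t. admissible p q n x t"
proof -
  define t where "t f = n f div 2 + (if f \<in> I then 1 else 0)" for f
  have I': "{..<p} \<inter> I = I" using I(1) by auto
  have "admissible p q n x t"
    unfolding admissible_def
  proof (intro conjI allI impI)
    fix f assume "f < p"
    then show "t f \<le> n f" using I(2)[of f] by (auto simp: t_def)
  next
    show "t 0 = n 0 div 2" using I(1) by (auto simp: t_def)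
  next
    have "(\<Sum>f<p. int (t f) * int f) = (\<Sum>f<p. int (n f div 2) * int f) + (\<Sum>f<p. if f \<in> I then int f else 0)"
      unfolding sum.distrib[symmetric] by (intro sum.cong) (auto simp: t_def algebra_simps)
    also have "(\<Sum>f<p. if f \<in> I then int f else 0) = (\<Sum>f\<in>I. int f)"
      using I' by (simp add: sum.If_cases)
    also have "((\<Sum>f<p. int (n f div 2) * int f) + (\<Sum>f\<in>I. int f)) mod int p = x mod int p"
      using mod_add_cong[OF refl x, of "\<Sum>f<p. int (n f div 2) * int f"] by simp
    finally show "(\<Sum>f<p. int (t f) * int f) mod int p = x mod int p" .
  next
    have "(\<Sum>f<p. half_prod (n f)) \<le> (\<Sum>f<p. t f * (n f - t f) + (if f \<in> {f\<in>I. even (n f)} then 1 else 0))"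
    proof (intro sum_mono)
      fix f
      show "half_prod (n f) \<le> t f * (n f - t f) + (if f \<in> {f\<in>I. even (n f)} then 1 else 0)"
        using half_prod_shift[of "n f"] half_prod_shift_odd[of "n f"] I(2)[of f]
        by (auto simp: t_def half_prod_def)
    qed
    also have "\<dots> = (\<Sum>f<p. t f * (n f - t f)) + card {f\<in>I. even (n f)}"
    proof -
      have "{..<p} \<inter> {f\<in>I. even (n f)} = {f\<in>I. even (n f)}" using I(1) by auto
      then show ?thesis by (simp add: sum.distrib sum.If_cases)
    qed
    finally show "q - 1 \<le> (\<Sum>f<p. t f * (n f - t f))" using total by simp
  qed
  then show ?thesis by blast
qed

text \<open>Modulo \<open>8\<close>, \<open>4 * p\<close> is \<open>4\<close> and
  \<open>m * m\<close> is \<open>0\<close>, \<open>1\<close> or \<open>4\<close>, so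
  \<open>4 * p - m * m\<close> cannot be \<open>5\<close>, \<open>6\<close> or \<open>7\<close>.
  This serves to derive \<open>p - 1 \<le> half_prod m\<close>.\<close>

lemma square_ge_of_odd:
  fixes p m :: nat
  assumes "odd p" "4 * p \<le> m * m + 7"
  shows "4 * p \<le> m * m + 4"
proof (cases "even m")
  case True
  then obtain k where "m = 2 * k" by (elim evenE)
  then show ?thesis using assms(2) by simp presburger
next
  case False
  then obtain k where k: "m = 2 * k + 1" by (elim oddE)
  obtain l where l: "p = 2 * l + 1" using assms(1) by (elim oddE)
  have "even (k * (k + 1))" by simp
  then obtain r where r: "k * (k + 1) = 2 * r" by (elim evenE)
  have "m * m = 8 * r + 1" using r by (simp add: k algebra_simps)
  then show ?thesis using assms(2) l by presburger
qed

text \<open>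
  The condition on \<open>c\<close> says that \<open>c\<close> is at least the floor of \<open>2 * sqrt (p - 2)\<close>, which by
  the Dias da Silva--Hamidoune theorem is the critical number of the group of order \<open>p\<close>.
\<close>

lemma exists_admissible:
  fixes p q c :: nat and n :: "nat \<Rightarrow> nat"
  assumes p: "prime p" "odd p" and c: "4 * p \<le> (c + 1) * (c + 1) + 7"
    and q: "p + c + 2 \<le> q" "q < 2 * p"
    and n: "1 \<le> n 0" "n 0 \<le> q" "(\<Sum>f<p. n f) = p + q - 1"
  shows "\<exists>t. admissible p q n x t"
proof -
  define U where "U = {f\<in>{1..<p}. 1 \<le> n f}"
  define S where "S = (\<Sum>f\<in>{1..<p}. n f)"
  have p3: "p \<ge> 3" using p prime_ge_2_nat[of p] by (cases "p = 2") auto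
  have U: "U \<subseteq> {1..<p}" "finite U" by (auto simp: U_def)
  have card_U: "card U \<le> p - 1" using card_mono[OF _ U(1)] by simp
  have nS: "n 0 + S = p + q - 1"
    using n(3) sum_lessThan_split_0[of p n] p3 by (simp add: S_def)
  \<comment> \<open>Slack comes from a large class of \<open>0\<close> or from few occurring
    residues; otherwise, \<open>p\<close> being odd, more than half of the nonzero residues
    occur.\<close>
  consider (large) "q + 2 \<le> n 0 + p" | (few) "n 0 + p \<le> q + 1" "2 * card U \<le> p - 1"
    | (many) "p + 1 \<le> 2 * card U"
  proof -
    have "2 * card U \<noteq> p" using p(2) by (metis dvd_triv_left)
    then show ?thesis using that by linarith
  qed
  then show ?thesis
  proof cases
    case large
    have "p - 1 \<le> S" using nS n(2) by linarith
    \<comment> \<open>Interval lengths of total \<open>p - 1\<close>. Starting at \<open>1\<close>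
      wherever there is room keeps the loss of class \<open>f\<close> within \<open>d f + 1\<close>,
      in total \<open>2 * (p - 1)\<close>.\<close>
    then obtain d where d: "\<And>f. d f \<le> n f" "(\<Sum>f\<in>{1..<p}. d f) = p - 1"
      using exists_le_sum_eq[of "{1..<p}" "p - 1" n] by (auto simp: S_def)
    show ?thesis
    proof (rule admissible_intervalI[OF p(1), where c = d and lo = "\<lambda>f. if d f < n f then 1 else 0"
          and d = "\<lambda>f. d f + 1"])
      fix f j assume j: "j \<le> d f"
      show "n f \<le> ((if d f < n f then 1 else 0) + j) * (n f - ((if d f < n f then 1 else 0) + j)) + (d f + 1)"
        using j le_mult_complement[of "j + 1" "n f"] by (cases "j + 1 < n f") auto
    next
      \<comment> \<open>In terms of \<open>k\<close>, the bound \<open>4 * p \<le> k * k + 3\<close>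
        yields \<open>half_prod (n 0) \<ge> n 0 + p - 2\<close>, exactly the surplus that covers the
        losses.\<close>
      define k where "k = n 0 - 2"
      have "c + 4 \<le> n 0" using large q(1) by linarith
      then have k: "n 0 = k + 2 \<and> c + 2 \<le> k" by (auto simp: k_def)
      have c1: "c \<ge> 1" using c p3 by (cases c) auto
      have "(c + 2) * (c + 2) \<le> k * k" using k by (intro mult_le_mono) auto
      then have "4 * p \<le> k * k + 3" using c c1 by (simp add: algebra_simps)
      moreover have "n 0 * n 0 = k * k + 4 * k + 4" by (simp add: k algebra_simps)
      ultimately have "n 0 + p \<le> half_prod (n 0) + 2"
        using four_half_prod[of "n 0"] k by linarith
      moreover have "(\<Sum>f\<in>{1..<p}. d f + 1) = (p - 1) + (p - 1)" by (simp add: sum.distrib d(2) del: One_nat_def)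
      ultimately show "q - 1 + (\<Sum>f\<in>{1..<p}. d f + 1) \<le> half_prod (n 0) + (\<Sum>f\<in>{1..<p}. n f)"
        using nS p3 q(1) unfolding S_def[symmetric] by linarith
    qed (use d in \<open>auto simp: Suc_le_eq\<close>)
  next
    case few
    \<comment> \<open>For \<open>n f \<ge> 2\<close>, \<open>t f\<close> ranges over
      \<open>1, ..., n f - 1\<close>, for \<open>n f = 1\<close> over \<open>0, 1\<close>; each
      occurring class then loses at most one.\<close>
    define b where "b f = (if 2 \<le> n f then n f - 2 else n f)" for f
    have sum_U: "(\<Sum>f\<in>{1..<p}. if f \<in> U then k else 0) = k * card U" for k
      using U(1) by (simp add: sum.If_cases Int_absorb1 mult.commute)
    have "S \<le> (\<Sum>f\<in>{1..<p}. b f + (if f \<in> U then 2 else 0))"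
      unfolding S_def by (intro sum_mono) (auto simp: b_def U_def)
    then have "S \<le> (\<Sum>f\<in>{1..<p}. b f) + 2 * card U"
      by (simp only: sum.distrib sum_U)
    then have b: "p - 1 \<le> (\<Sum>f\<in>{1..<p}. b f)"
      using few nS by linarith
    show ?thesis
    proof (rule admissible_intervalI[OF p(1) b, where lo = "\<lambda>f. if 2 \<le> n f then 1 else 0"
          and d = "\<lambda>f. if f \<in> U then 1 else 0"])
      fix f j assume f: "f \<in> {1..<p}" "j \<le> b f"
      then show "n f \<le> ((if 2 \<le> n f then 1 else 0) + j) * (n f - ((if 2 \<le> n f then 1 else 0) + j)) + (if f \<in> U then 1 else 0)"
        using le_mult_complement[of "j + 1" "n f"] by (auto simp: b_def U_def)
    next
      show "q - 1 + (\<Sum>f\<in>{1..<p}. if f \<in> U then 1 else 0) \<le> half_prod (n 0) + (\<Sum>f\<in>{1..<p}. n f)"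
        unfolding sum_U S_def[symmetric] using half_prod_ge[of "n 0"] card_U nS p3 q(1) by linarith
    qed (auto simp: b_def)
  next
    case many
    define Z where "Z = {f\<in>{1..<p}. n f = 0}"
    define Odd where "Odd = {f\<in>{1..<p}. odd (n f)}"
    \<comment> \<open>The residue by which the balanced choice misses \<open>x\<close>.\<close>
    define y where "y = x - (\<Sum>f<p. int (n f div 2) * int f)"
    show ?thesis
    proof (cases "c \<le> card Odd")
      case True
      \<comment> \<open>With \<open>0\<close> adjoined, \<open>Odd\<close> provides \<open>m\<close>
        residues; sums of \<open>m div 2\<close> of them cover everything modulo \<open>p\<close>,
        and increments in odd classes are free.\<close>
      define m where "m = card Odd + 1"
      have "(c + 1) * (c + 1) \<le> m * m" using True by (intro mult_le_mono) (auto simp: m_def)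
      then have "4 * p \<le> m * m + 4" using square_ge_of_odd[OF p(2), of m] c by linarith
      then have "p - 1 \<le> half_prod m" using four_half_prod[of m] by linarith
      then have "p - 1 \<le> (m div 2) * (card Odd + 1 - m div 2)" by (simp add: half_prod_def m_def)
      moreover have "m div 2 \<le> card Odd + 1" by (simp add: m_def)
      moreover have "Odd \<subseteq> {1..<p}" by (auto simp: Odd_def)
      ultimately obtain I where I: "I \<subseteq> Odd" "(\<Sum>f\<in>I. int f) mod int p = y mod int p"
        using exists_subset_sum[OF p(1), of Odd "m div 2" y] by blast
      show ?thesis
      proof (rule admissible_shiftI[OF p(1) _ _ I(2)[unfolded y_def]])
        have "{f\<in>I. even (n f)} = {}" using I(1) by (auto simp: Odd_def)
        then have "card {f\<in>I. even (n f)} = 0" by (simp only: card.empty)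
        moreover have "(\<Sum>f<p. n f) \<le> (\<Sum>f<p. half_prod (n f) + 1)"
          by (intro sum_mono half_prod_ge)
        then have "p + q - 1 \<le> (\<Sum>f<p. half_prod (n f)) + p"
          unfolding n(3) sum.distrib by simp
        ultimately show "q - 1 + card {f\<in>I. even (n f)} \<le> (\<Sum>f<p. half_prod (n f))"
          using q(1) by linarith
      qed (use I(1) in \<open>auto simp: Odd_def Suc_le_eq odd_pos\<close>)
    next
      case False
      \<comment> \<open>If all classes had at most three elements, the total would be at most
        \<open>3 + 2 * (p - 1) + card Odd\<close>, contradicting
        \<open>p + c + 2 \<le> q\<close>.\<close>
      obtain g where g: "g < p" "4 \<le> n g"
      proof (rule ccontr)
        assume "\<not> thesis"
        then have small: "n f \<le> 3" if "f < p" for f using that \<open>\<And>g. g < p \<Longrightarrow> 4 \<le> n g \<Longrightarrow> thesis\<close> by force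
        have "S \<le> (\<Sum>f\<in>{1..<p}. 2 + (if f \<in> Odd then 1 else 0))"
          unfolding S_def
        proof (intro sum_mono)
          fix f assume f: "f \<in> {1..<p}"
          then have "n f \<le> 3" using small by simp
          then show "n f \<le> 2 + (if f \<in> Odd then 1 else 0)"
            using f by (cases "n f = 3") (auto simp: Odd_def)
        qed
        also have "\<dots> = 2 * (p - 1) + card Odd"
        proof -
          have "{1..<p} \<inter> Odd = Odd" by (auto simp: Odd_def)
          then show ?thesis unfolding sum.distrib by (simp add: sum.If_cases)
        qed
        finally show False using small[of 0] False nS q(1) p3 by linarith
      qed
      \<comment> \<open>Each empty class and the class \<open>g\<close> exceed the bound
        \<open>n f - 1\<close> by one, so \<open>card Z + 1\<close> paid increments are
        affordable.\<close>
      have budget: "q + card Z \<le> (\<Sum>f<p. half_prod (n f))"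
      proof -
        have "(\<Sum>f<p. n f + (if f \<in> Z then 1 else 0) + (if f = g then 1 else 0)) \<le> (\<Sum>f<p. half_prod (n f) + 1)"
        proof (intro sum_mono)
          fix f
          show "n f + (if f \<in> Z then 1 else 0) + (if f = g then 1 else 0) \<le> half_prod (n f) + 1"
            using half_prod_ge[of "n f"] half_prod_ge'[of "n f"] g(2) by (auto simp: Z_def)
        qed
        moreover have "{..<p} \<inter> Z = Z" by (auto simp: Z_def)
        ultimately have "(p + q - 1) + card Z + 1 \<le> (\<Sum>f<p. half_prod (n f)) + p"
          using g(1) unfolding sum.distrib n(3) by (simp add: sum.If_cases)
        then show ?thesis using q(1) by linarith
      qed
      have "\<exists>I\<subseteq>U. card I \<le> card Z + 1 \<and> (\<Sum>f\<in>I. int f) mod int p = y mod int p"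
      proof -
        define f where "f = nat (y mod int p)"
        have f: "int f = y mod int p" "f < p" using p3 by (auto simp: f_def nat_less_iff)
        consider "f = 0" | "f \<in> U" | "f \<in> Z" using f(2) by (cases "n f = 0"; cases "f = 0") (auto simp: U_def Z_def)
        then show ?thesis
        proof cases
          case 1
          then show ?thesis using f(1) by (intro exI[of _ "{}"]) auto
        next
          case 2
          then show ?thesis using f(1) by (intro exI[of _ "{f}"]) auto
        next
          \<comment> \<open>Now \<open>Z\<close> is nonempty, so two increments are allowed; they
            suffice because \<open>2 * (card U - 1) \<ge> p - 1\<close>.\<close>
          case 3
          moreover have "finite Z" by (simp add: Z_def)
          ultimately have "1 \<le> card Z" by (metis One_nat_def Suc_leI card_gt_0_iff empty_iff)
          moreover have "p - 1 \<le> 2 * (card U + 1 - 2)" using many p3 by linarith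
          then obtain I where "I \<subseteq> U" "card I \<le> 2" "(\<Sum>f\<in>I. int f) mod int p = y mod int p"
            using exists_subset_sum[OF p(1) U(1), of 2 y] many p3 by auto
          ultimately show ?thesis by (intro exI[of _ I]) auto
        qed
      qed
      then obtain I where I: "I \<subseteq> U" "card I \<le> card Z + 1" "(\<Sum>f\<in>I. int f) mod int p = y mod int p" by blast
      show ?thesis
      proof (rule admissible_shiftI[OF p(1) _ _ I(3)[unfolded y_def]])
        have "card {f\<in>I. even (n f)} \<le> card I"
          using I(1) U(2) finite_subset by (intro card_mono) auto
        then show "q - 1 + card {f\<in>I. even (n f)} \<le> (\<Sum>f<p. half_prod (n f))"
          using budget I(2) q p3 by linarith
      qed (use I(1) in \<open>auto simp: U_def\<close>)
    qed
  qed
qed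

section \<open>Cyclic groups of order \<open>p * q\<close>\<close>

lemma eq_of_mod_eq_coprime:
  fixes k l m n :: int
  assumes "coprime m n" "k mod m = l mod m" "k mod n = l mod n"
  shows "k mod (m * n) = l mod (m * n)"
  using assms by (simp add: mod_eq_dvd_iff divides_mult)

text \<open>The sizes \<open>t f\<close> prescribe the sum modulo \<open>p\<close>,
  Cauchy--Davenport for the sets \<open>X f\<close> prescribes it modulo \<open>q\<close>, and the
  Chinese remainder theorem combines both.\<close>

lemma exists_subset_sum_pq:
  fixes p q c :: nat and K :: "int set"
  assumes p: "prime p" "odd p" and q: "prime q" and c: "4 * p \<le> (c + 1) * (c + 1) + 7"
    and pq: "p + c + 2 \<le> q" "q < 2 * p"
    and K: "K \<subseteq> {1..<int (p * q)}" "card K = p + q - 2"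
  shows "\<exists>I\<subseteq>K. I \<noteq> {} \<and> \<Sum>I mod int (p * q) = z mod int (p * q)"
proof -
  define A where "A f = {k \<in> insert 0 K. k mod int p = int f}" for f :: nat
  define n where "n f = card (A f)" for f
  have p3: "p \<ge> 3" using p prime_ge_2_nat[of p] by (cases "p = 2") auto
  have coprime: "coprime (int p) (int q)"
    using p q pq(1) primes_coprime[of p q] by simp
  have fin: "finite K" using K(1) finite_subset by blast
  have fin_A: "finite (A f)" for f using fin by (simp add: A_def)
  have zero_notin: "0 \<notin> K" using K(1) by auto
  have A_range: "A f \<subseteq> {0..<int (p * q)}" for f using K(1) p3 pq by (auto simp: A_def)
  have disj: "f = g" if "k \<in> A f" "k \<in> A g" for f g k using that by (auto simp: A_def)
  have A_UN: "(\<Union>f<p. A f) = insert 0 K"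
  proof
    show "insert 0 K \<subseteq> (\<Union>f<p. A f)"
    proof
      fix k assume "k \<in> insert 0 K"
      then have "k \<in> A (nat (k mod int p))" using p3 by (simp add: A_def)
      moreover have "nat (k mod int p) < p" using p3 by (simp add: nat_less_iff)
      ultimately show "k \<in> (\<Union>f<p. A f)" by blast
    qed
  qed (auto simp: A_def)
  \<comment> \<open>Members of one class agree modulo \<open>p\<close>, so their residues modulo
    \<open>q\<close> must differ.\<close>
  have inj: "inj_on (\<lambda>x. x mod int q) (A f)" for f
  proof (rule inj_onI)
    fix k l assume kl: "k \<in> A f" "l \<in> A f" "k mod int q = l mod int q"
    then have "k mod (int p * int q) = l mod (int p * int q)"
      by (intro eq_of_mod_eq_coprime coprime) (auto simp: A_def)
    moreover have "k \<in> {0..<int p * int q}" "l \<in> {0..<int p * int q}"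
      using kl A_range[of f] by auto
    ultimately show "k = l" by simp
  qed
  have q_card: "card ((\<lambda>x. x mod int q) ` X) \<le> q" for X
  proof -
    have "card ((\<lambda>x. x mod int q) ` X) \<le> card {0..<int q}"
      using pq p3 by (intro card_mono) auto
    then show ?thesis by simp
  qed
  have n0: "1 \<le> n 0" "n 0 \<le> q"
  proof -
    have "0 \<in> A 0" by (simp add: A_def)
    then show "1 \<le> n 0" unfolding n_def using fin_A by (metis One_nat_def Suc_leI card_gt_0_iff empty_iff)
    show "n 0 \<le> q" using q_card[of "A 0"] inj by (simp add: n_def card_image)
  qed
  have sum_n: "(\<Sum>f<p. n f) = p + q - 1"
  proof -
    have "card (\<Union>f<p. A f) = (\<Sum>f<p. n f)"
      unfolding n_def by (rule card_UN_disjoint) (use fin_A disj in auto)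
    then show ?thesis using fin zero_notin K(2) p3 pq by (simp add: A_UN)
  qed
  obtain t where "admissible p q n z t"
    using exists_admissible[OF p c pq n0 sum_n] by blast
  then have t: "\<And>f. f < p \<Longrightarrow> t f \<le> n f" "t 0 = n 0 div 2"
    "(\<Sum>f<p. int (t f) * int f) mod int p = z mod int p" "q - 1 \<le> (\<Sum>f<p. t f * (n f - t f))"
    by (auto simp: admissible_def)
  define X where "X f = (\<lambda>I. \<Sum>I) ` {I. I \<subseteq> A f \<and> card I = t f}" for f
  \<comment> \<open>Capped because the Dias da Silva--Hamidoune theorem needs a bound below
    \<open>q\<close>.\<close>
  define m where "m f = min (q - 1) (t f * (n f - t f))" for f
  have fin_X: "finite (X f)" for f
    unfolding X_def by (rule finite_imageI, rule finite_subset[of _ "Pow (A f)"]) (use fin_A in auto)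
  have m_less: "m f < card ((\<lambda>x. x mod int q) ` X f)" if "f < p" for f
  proof -
    have "m f < card ((\<lambda>I. \<Sum>I mod int q) ` {I. I \<subseteq> A f \<and> card I = t f})"
      using t(1)[OF that] pq p3
      by (intro dias_da_silva_hamidoune[OF q fin_A inj]) (auto simp: m_def n_def)
    then show ?thesis by (simp add: X_def image_image)
  qed
  have sum_m: "q - 1 \<le> (\<Sum>f<p. m f)"
  proof (cases "\<exists>f<p. q - 1 \<le> t f * (n f - t f)")
    case True
    then obtain f where "f < p" "m f = q - 1" by (auto simp: m_def)
    then show ?thesis using member_le_sum[of f "{..<p}" m] by simp
  next
    case False
    then have "(\<Sum>f<p. m f) = (\<Sum>f<p. t f * (n f - t f))"
      by (intro sum.cong) (auto simp: m_def min_def)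
    then show ?thesis using t(4) by simp
  qed
  have "\<exists>x. (\<forall>f\<in>{..<p}. x f \<in> X f) \<and> (\<Sum>f<p. x f) mod int q = z mod int q"
    by (rule cauchy_davenport_family[OF q, where m = m]) (use fin_X m_less sum_m in auto)
  then obtain x where x: "\<forall>f\<in>{..<p}. x f \<in> X f" "(\<Sum>f<p. x f) mod int q = z mod int q" by blast
  have "\<exists>I. I \<subseteq> A f \<and> card I = t f \<and> x f = \<Sum>I" if "f < p" for f
    using x(1) that unfolding X_def by blast
  then obtain I where I: "\<And>f. f < p \<Longrightarrow> I f \<subseteq> A f" "\<And>f. f < p \<Longrightarrow> card (I f) = t f"
    "\<And>f. f < p \<Longrightarrow> x f = \<Sum>(I f)"
    by metis
  have fin_I: "finite (I f)" if "f < p" for f using I(1)[OF that] fin_A finite_subset by blast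
  define J where "J = (\<Union>f<p. I f)"
  have "\<Sum>J = (\<Sum>f<p. x f)"
  proof -
    have "\<Sum>J = (\<Sum>f<p. \<Sum>(I f))"
      unfolding J_def
    proof (rule sum.UNION_disjoint)
      show "\<forall>i\<in>{..<p}. \<forall>j\<in>{..<p}. i \<noteq> j \<longrightarrow> I i \<inter> I j = {}"
        using I(1) disj by (metis disjoint_iff lessThan_iff subsetD)
    qed (use fin_I in auto)
    then show ?thesis using I(3) by simp
  qed
  moreover have "(\<Sum>f<p. x f) mod int p = z mod int p"
  proof -
    have "x f mod int p = (int (t f) * int f) mod int p" if f: "f < p" for f
    proof -
      have "(\<Sum>k\<in>I f. k) mod int p = (\<Sum>k\<in>I f. k mod int p) mod int p"
        by (simp add: mod_sum_eq)
      also have "(\<Sum>k\<in>I f. k mod int p) = (\<Sum>k\<in>I f. int f)"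
        using I(1)[OF f] by (intro sum.cong) (auto simp: A_def)
      finally show ?thesis using I(2,3)[OF f] by simp
    qed
    then have eq: "(\<Sum>f<p. x f mod int p) = (\<Sum>f<p. (int (t f) * int f) mod int p)"
      by simp
    have "(\<Sum>f<p. x f) mod int p = (\<Sum>f<p. x f mod int p) mod int p"
      by (rule mod_sum_eq[symmetric])
    also have "\<dots> = (\<Sum>f<p. int (t f) * int f) mod int p"
      unfolding eq by (rule mod_sum_eq)
    finally show ?thesis using t(3) by simp
  qed
  ultimately have "\<Sum>J mod (int p * int q) = z mod (int p * int q)"
    using x(2) by (intro eq_of_mod_eq_coprime coprime) auto
  moreover have "\<Sum>(J - {0}) = \<Sum>J"
    using fin_I by (intro sum.mono_neutral_left) (auto simp: J_def)
  moreover have "J - {0} \<subseteq> K"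
    using I(1) by (fastforce simp: J_def A_def)
  \<comment> \<open>If only \<open>0\<close> were used, every class but that of \<open>0\<close>
    would contribute nothing. Since \<open>t 0 = n 0 div 2\<close>, the total would be at most
    \<open>2\<close>, below \<open>q - 1\<close>.\<close>
  moreover have "J - {0} \<noteq> {}"
  proof
    assume "J - {0} = {}"
    then have sub: "I f \<subseteq> {0}" if "f < p" for f using that by (auto simp: J_def)
    have "t f * (n f - t f) = 0" if "f \<in> {1..<p}" for f
    proof -
      have "0 \<notin> A f" using that by (simp add: A_def)
      then have "I f = {}" using sub[of f] I(1)[of f] that by auto
      then show ?thesis using I(2)[of f] that by simp
    qed
    then have "(\<Sum>f<p. t f * (n f - t f)) = t 0 * (n 0 - t 0)"
      using sum_lessThan_split_0[of p "\<lambda>f. t f * (n f - t f)"] p3 by simp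
    moreover have "t 0 \<le> 1" using sub[of 0] I(2)[of 0] p3 card_mono[of "{0}" "I 0"] by simp
    moreover from this have "n 0 - t 0 \<le> 2" unfolding t(2) by linarith
    ultimately have "q - 1 \<le> 1 * 2" using t(4) mult_le_mono[of "t 0" 1 "n 0 - t 0" 2] by linarith
    then show False using pq p3 by linarith
  qed
  ultimately show ?thesis by (intro exI[of _ "J - {0}"]) simp
qed

lemma non_spanning_subset_pq:
  fixes p q :: nat
  assumes p: "3 \<le> p" "p < q"
  obtains K where "K \<subseteq> {1..<int (p * q)}" "card K = p + q - 3"
    "\<And>I. I \<subseteq> K \<Longrightarrow> \<Sum>I mod int (p * q) \<noteq> (int p - 1) mod int (p * q)"
proof
  define K1 where "K1 = (\<lambda>i. int p * int i) ` {1..<q}"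
  define K2 where "K2 = (\<lambda>i. 1 + int p * int i) ` {0..<p - 2}"
  have res1: "k mod int p = 0" if "k \<in> K1" for k using that by (auto simp: K1_def)
  have res2: "k mod int p = 1" if "k \<in> K2" for k using that p by (auto simp: K2_def)
  have fin: "finite K1" "finite K2" by (auto simp: K1_def K2_def)
  have card_K2: "card K2 = p - 2"
    unfolding K2_def using p by (subst card_image) (auto simp: inj_on_def)
  have card_K1: "card K1 = q - 1"
    unfolding K1_def using p by (subst card_image) (auto simp: inj_on_def)
  have "K1 \<inter> K2 = {}" using res1 res2 by fastforce
  then show "card (K1 \<union> K2) = p + q - 3"
    using fin card_K1 card_K2 p by (simp add: card_Un_disjoint)
  show "K1 \<union> K2 \<subseteq> {1..<int (p * q)}"
  proof (rule Un_least)
    show "K1 \<subseteq> {1..<int (p * q)}"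
    proof
      fix k assume "k \<in> K1"
      then obtain i where "i \<in> {1..<q}" "k = int p * int i" unfolding K1_def by blast
      then have i: "k = int (p * i)" "1 \<le> i" "i < q" by auto
      then have "1 \<le> p * i" "p * i < p * q" using p by auto
      then show "k \<in> {1..<int (p * q)}" using i(1) by (simp del: of_nat_mult)
    qed
    show "K2 \<subseteq> {1..<int (p * q)}"
    proof
      fix k assume "k \<in> K2"
      then obtain i where "i \<in> {0..<p - 2}" "k = 1 + int p * int i" unfolding K2_def by blast
      then have i: "k = int (1 + p * i)" "i < p - 2" by auto
      then have "p * (i + 1) \<le> p * q" using p by (intro mult_le_mono) auto
      then have "1 + p * i < p * q" using p unfolding distrib_left by linarith
      then show "k \<in> {1..<int (p * q)}" using i(1) by (simp del: of_nat_mult)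
    qed
  qed
  fix I assume I: "I \<subseteq> K1 \<union> K2"
  then have fin_I: "finite I" using fin finite_subset by blast
  show "\<Sum>I mod int (p * q) \<noteq> (int p - 1) mod int (p * q)"
  proof
    assume "\<Sum>I mod int (p * q) = (int p - 1) mod int (p * q)"
    then have "\<Sum>I mod int (p * q) mod int p = (int p - 1) mod int (p * q) mod int p" by simp
    then have "\<Sum>I mod int p = (int p - 1) mod int p"
      by (simp add: mod_mod_cancel)
    also have "\<dots> = int p - 1"
      using p by (intro mod_pos_pos_trivial) auto
    finally have eq: "\<Sum>I mod int p = int p - 1" .
    \<comment> \<open>Modulo \<open>p\<close> a sum merely counts its terms from \<open>K2\<close>,
      and \<open>p - 2\<close> of them cannot reach \<open>p - 1\<close>.\<close>
    have "(\<Sum>k\<in>I. k mod int p) = (\<Sum>k\<in>I. if k \<in> K2 then 1 else 0)"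
      using I res1 res2 \<open>K1 \<inter> K2 = {}\<close> by (intro sum.cong) auto
    also have "\<dots> = int (card (I \<inter> K2))"
      using fin_I by (simp add: sum.If_cases)
    finally have "(\<Sum>k\<in>I. k mod int p) mod int p = int (card (I \<inter> K2)) mod int p"
      by (rule arg_cong)
    then have "\<Sum>I mod int p = int (card (I \<inter> K2)) mod int p"
      unfolding mod_sum_eq .
    moreover have "card (I \<inter> K2) \<le> p - 2"
      using card_mono[of K2 "I \<inter> K2"] fin card_K2 by simp
    ultimately show False using eq p by simp
  qed
qed

section \<open>From integers to the group\<close>

text \<open>\<open>\<phi>\<close> maps an integer to that power of a generator. Products over images
  are stated within one period, where \<open>\<phi>\<close> is injective and no summands
  collapse.\<close>

lemma cyclic_group_coordinate:
  fixes G :: "('a, 'b) monoid_scheme" (structure)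
  assumes "group G" "cyclic_group G" "order G = N" "0 < N"
  obtains \<phi> :: "int \<Rightarrow> 'a" where "\<And>k l. \<phi> k = \<phi> l \<longleftrightarrow> k mod int N = l mod int N"
    "range \<phi> = carrier G" "\<phi> 0 = \<one>"
    "\<And>I. I \<subseteq> {1..<int N} \<Longrightarrow> finprod G (\<lambda>a. a) (\<phi> ` I) = \<phi> (\<Sum>I)"
proof -
  interpret group G by fact
  interpret comm_group G by (rule cyclic_imp_abelian_group) fact
  obtain x where x: "x \<in> carrier G" "carrier G = range (\<lambda>n::int. x [^] n)"
    using assms(2) cyclic_group by blast
  have "generate G {x} = carrier G" using generate_pow[OF x(1)] x(2) by auto
  then have "ord x = N" using generate_pow_card[OF x(1)] assms(3) by (simp add: Coset.order_def)
  then have inj: "x [^] k = x [^] l \<longleftrightarrow> k mod int N = l mod int N" for k l :: int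
    using int_pow_eq[OF x(1), of k l] by (auto simp: mod_eq_dvd_iff dvd_diff_commute)
  have "finprod G (\<lambda>a. a) ((\<lambda>k. x [^] k) ` I) = x [^] (\<Sum>I)" if I: "I \<subseteq> {1..<int N}" for I
  proof -
    have "inj_on (\<lambda>k. x [^] k) I"
    proof (rule inj_onI)
      fix k l assume kl: "k \<in> I" "l \<in> I" "x [^] k = x [^] l"
      then have "k \<in> {1..<int N}" "l \<in> {1..<int N}" using I by auto
      then show "k = l" using kl(3) by (simp add: inj)
    qed
    then have "finprod G (\<lambda>a. a) ((\<lambda>k. x [^] k) ` I) = finprod G (\<lambda>k. x [^] k) I"
      using x(1) by (intro finprod_reindex) auto
    also have "\<dots> = x [^] (\<Sum>I)"
    proof -
      have "finite I" using I finite_subset by blast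
      then show ?thesis
        using x(1) by (induction I rule: finite_induct) (auto simp: int_pow_mult)
    qed
    finally show ?thesis .
  qed
  then show thesis using that[of "\<lambda>k. x [^] k"] inj x by simp
qed

theorem theorem1p1:
  fixes G :: "('a, 'b) monoid_scheme" and p q :: nat
  assumes "group G" and "cyclic_group G" and "order G = p * q"
    and "prime p" and "prime q"
    and "int p + \<lfloor>2 * sqrt (real p - 2)\<rfloor> + 1 < int q" and "q < 2 * p"
  shows "critical_number G = p + q - 2"
proof -
  interpret group G by fact
  interpret comm_group G by (rule cyclic_imp_abelian_group) fact
  define c where "c = nat \<lfloor>2 * sqrt (real p - 2)\<rfloor>"
  have p2: "p \<ge> 2" using assms(4) by (rule prime_ge_2_nat)
  then have "0 \<le> 2 * sqrt (real p - 2)" by simp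
  then have c: "int c = \<lfloor>2 * sqrt (real p - 2)\<rfloor>" by (simp add: c_def)
  then have pq: "p + c + 2 \<le> q" using assms(6) by linarith
  \<comment> \<open>For \<open>p = 2\<close> the bounds would read
    \<open>4 + c \<le> q < 4\<close>.\<close>
  have odd: "odd p" using pq assms(4,7) p2 primes_dvd_imp_eq[of 2 p] two_is_prime_nat by fastforce
  have p3: "3 \<le> p" using odd p2 by (cases "p = 2") auto
  \<comment> \<open>Squaring \<open>2 * sqrt (p - 2) < c + 1\<close> gives a strict inequality with
    constant \<open>8\<close>, hence \<open>7\<close> over the integers.\<close>
  have c_sq: "4 * p \<le> (c + 1) * (c + 1) + 7"
  proof -
    have "2 * sqrt (real p - 2) < real (c + 1)" using c by linarith
    then have "(2 * sqrt (real p - 2))\<^sup>2 < (real (c + 1))\<^sup>2"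
      using p2 by (intro power_strict_mono) auto
    then have "4 * (real p - 2) < real ((c + 1) * (c + 1))"
      using p2 by (simp add: power_mult_distrib power2_eq_square algebra_simps)
    then have "real (4 * p) < real ((c + 1) * (c + 1) + 8)" by simp
    then show ?thesis unfolding of_nat_less_iff by linarith
  qed
  have N: "0 < p * q" using p3 pq by simp
  obtain \<phi> :: "int \<Rightarrow> 'a" where \<phi>: "\<And>k l. \<phi> k = \<phi> l \<longleftrightarrow> k mod int (p * q) = l mod int (p * q)"
    "range \<phi> = carrier G" "\<phi> 0 = \<one>\<^bsub>G\<^esub>"
    "\<And>I. I \<subseteq> {1..<int (p * q)} \<Longrightarrow> finprod G (\<lambda>a. a) (\<phi> ` I) = \<phi> (\<Sum>I)"
    using cyclic_group_coordinate[OF assms(1,2,3) N] by blast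
  have inj: "inj_on \<phi> {1..<int (p * q)}"
    by (rule inj_onI) (simp add: \<phi>(1))
  have surj: "\<exists>k\<in>{1..<int (p * q)}. \<phi> k = s" if s: "s \<in> carrier G - {\<one>\<^bsub>G\<^esub>}" for s
  proof -
    have "s \<in> range \<phi>" using s \<phi>(2) by simp
    then obtain k where k: "\<phi> k = s" by blast
    define l where "l = k mod int (p * q)"
    have l: "0 \<le> l" "l < int (p * q)" using N unfolding l_def by (simp_all del: of_nat_mult)
    have "\<phi> l = s" using k \<phi>(1)[of l k] by (simp add: l_def)
    moreover have "l \<noteq> 0" using calculation s \<phi>(3) by auto
    ultimately show ?thesis using l by (intro bexI[of _ l]) auto
  qed
  show ?thesis
    unfolding critical_number_def
  proof (rule Least_equality)
    show "0 < p + q - 2 \<and> (\<forall>S. S \<subseteq> carrier G - {\<one>\<^bsub>G\<^esub>} \<and> p + q - 2 \<le> card S \<longrightarrow> subset_sums G S = carrier G)"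
    proof (intro conjI allI impI)
      fix S assume S: "S \<subseteq> carrier G - {\<one>\<^bsub>G\<^esub>} \<and> p + q - 2 \<le> card S"
      \<comment> \<open>Exactly \<open>p + q - 2\<close> elements are kept; every sum over
        \<open>S'\<close> is also one over \<open>S\<close>.\<close>
      obtain S' where S': "S' \<subseteq> S" "card S' = p + q - 2"
        using S obtain_subset_with_card_n by metis
      define K where "K = {k\<in>{1..<int (p * q)}. \<phi> k \<in> S'}"
      have K: "\<phi> ` K = S'"
      proof
        show "S' \<subseteq> \<phi> ` K"
        proof
          fix s assume s: "s \<in> S'"
          then have "s \<in> carrier G - {\<one>\<^bsub>G\<^esub>}" using S S'(1) by blast
          then obtain k where "k \<in> {1..<int (p * q)}" "\<phi> k = s" using surj by blast
          then show "s \<in> \<phi> ` K" using s unfolding K_def by blast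
        qed
      qed (auto simp: K_def)
      have "inj_on \<phi> K" by (rule inj_on_subset[OF inj]) (auto simp: K_def)
      then have card_K: "card K = p + q - 2" using K S'(2) card_image by metis
      have K_sub: "K \<subseteq> {1..<int (p * q)}" by (auto simp: K_def)
      show "subset_sums G S = carrier G"
      proof
        show "subset_sums G S \<subseteq> carrier G"
          using S by (auto simp: subset_sums_def intro!: finprod_closed)
        show "carrier G \<subseteq> subset_sums G S"
        proof
          fix y assume "y \<in> carrier G"
          then have "y \<in> range \<phi>" using \<phi>(2) by simp
          then obtain z where z: "y = \<phi> z" by blast
          obtain I where I: "I \<subseteq> K" "I \<noteq> {}" "\<Sum>I mod int (p * q) = z mod int (p * q)"
            using exists_subset_sum_pq[OF assms(4) odd assms(5) c_sq pq assms(7) K_sub card_K] by blast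
          have "y = finprod G (\<lambda>a. a) (\<phi> ` I)"
            using I K_sub \<phi>(4)[of I] by (simp add: z \<phi>(1))
          moreover have "\<phi> ` I \<subseteq> S" "\<phi> ` I \<noteq> {}" using I K S'(1) by auto
          ultimately show "y \<in> subset_sums G S" unfolding subset_sums_def by blast
        qed
      qed
    qed (use p3 in simp)
  next
    fix l assume l: "0 < l \<and> (\<forall>S. S \<subseteq> carrier G - {\<one>\<^bsub>G\<^esub>} \<and> l \<le> card S \<longrightarrow> subset_sums G S = carrier G)"
    show "p + q - 2 \<le> l"
    proof (rule ccontr)
      assume "\<not> p + q - 2 \<le> l"
      \<comment> \<open>A smaller \<open>l\<close> would apply to the non-spanning set of size
        \<open>p + q - 3\<close>.\<close>
      then have l_le: "l \<le> p + q - 3" by linarith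
      obtain K where K: "K \<subseteq> {1..<int (p * q)}" "card K = p + q - 3"
        "\<And>I. I \<subseteq> K \<Longrightarrow> \<Sum>I mod int (p * q) \<noteq> (int p - 1) mod int (p * q)"
        using non_spanning_subset_pq[of p q] p3 pq by auto
      have "card (\<phi> ` K) = p + q - 3"
        using inj_on_subset[OF inj K(1)] K(2) by (simp add: card_image)
      moreover have "\<phi> ` K \<subseteq> carrier G - {\<one>\<^bsub>G\<^esub>}"
      proof
        fix s assume "s \<in> \<phi> ` K"
        then obtain k where k: "k \<in> {1..<int (p * q)}" "s = \<phi> k" using K(1) by blast
        then have "k mod int (p * q) = k" by simp
        then have "\<phi> k \<noteq> \<phi> 0" using k by (simp add: \<phi>(1) del: of_nat_mult)
        then show "s \<in> carrier G - {\<one>\<^bsub>G\<^esub>}" using k(2) \<phi>(2,3) by auto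
      qed
      ultimately have "subset_sums G (\<phi> ` K) = carrier G" using l l_le by auto
      then have "\<phi> (int p - 1) \<in> subset_sums G (\<phi> ` K)" using \<phi>(2) rangeI[of \<phi>] by simp
      then obtain S where S: "S \<subseteq> \<phi> ` K" "\<phi> (int p - 1) = finprod G (\<lambda>a. a) S"
        by (auto simp: subset_sums_def)
      then obtain I where I: "I \<subseteq> K" "S = \<phi> ` I" by (auto simp: subset_image_iff)
      then have "\<phi> (int p - 1) = \<phi> (\<Sum>I)" using S(2) \<phi>(4)[of I] K(1) by auto
      then show False using K(3)[OF I(1)] by (simp add: \<phi>(1))
    qed
  qed
qed

end
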